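(* Let $\xi,\zeta$ be admissible families with $E[\operatorname{ess\,sup}_{\theta\in\mathcal T}(\xi(\theta))^-]<+\infty$, $E[\operatorname{ess\,sup}_{\theta\in\mathcal T}(\zeta(\theta))^+]<+\infty$ and $\xi(T)=\zeta(T)=0$ a.s., and let $J,J'$ be the associated families. Suppose that $J(0)<+\infty$ and that the families $(\xi(\theta),\theta\in\mathcal T)$ and $(-\zeta(\theta),\theta\in\mathcal T)$ are right-USCE. Then the game is fair and the common value function equals $Y=J-J'$, i.e. for each $\theta\in\mathcal T$, $$Y(\theta)=\underline V(\theta)=\overline V(\theta)\quad\text{a.s.}$$
   Context: Filtered probability space $(\Omega,\mathcal F,(\mathcal F_t)_{0\le t\le T},P)$ satisfying the usual conditions, $\mathcal F=\mathcal F_T$, $\mathcal F_0$ trivial, $T\in(0,\infty)$. $\mathcal T$: stopping times valued in $[0,T]$; $\mathcal T_S=\{\theta\in\mathcal T:\theta\ge S\text{ a.s.}\}$. A family $\phi=(\phi(\theta),\theta\in\mathcal T)$ of $\overline{\mathbb R}$-valued random variables is admissible if each $\phi(\theta)$ is $\mathcal F_\theta$-measurable and $\phi(\theta)=\phi(\theta')$ a.s. on $\{\theta=\theta'\}$. An admissible family $\phi$ with $E[\operatorname{ess\,sup}_\theta\phi(\theta)^-]<\infty$ is right-USCE (right-upper semicontinuous in expectation along stopping times) if for all $\theta\in\mathcal T$ and all sequences $(\theta_n)$ in $\mathcal T$ with $\theta_n\downarrow\theta$, $E[\phi(\theta)]\ge\limsup_nE[\phi(\theta_n)]$. Families $J,J'$: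 $J_0=J'_0=0$, $J_{n+1}(\theta)=\operatorname{ess\,sup}_{\tau\in\mathcal T_\theta}E[J'_n(\tau)+\xi(\tau)\mid\mathcal F_\theta]$, $J'_{n+1}(\theta)=\operatorname{ess\,sup}_{\sigma\in\mathcal T_\theta}E[J_n(\sigma)-\zeta(\sigma)\mid\mathcal F_\theta]$, $J=\limsup_nJ_n$, $J'=\limsup_nJ'_n$ (pointwise in $\theta$); when $J(0)<\infty$, $Y:=J-J'$. Criterion $I_\theta(\tau,\sigma)=E[\xi(\tau)\mathbf 1_{\{\tau\le\sigma\}}+\zeta(\sigma)\mathbf 1_{\{\sigma<\tau\}}\mid\mathcal F_\theta]$ for $(\tau,\sigma)\in\mathcal T_\theta^2$; $\underline V(\theta)=\operatorname{ess\,sup}_{\tau\in\mathcal T_\theta}\operatorname{ess\,inf}_{\sigma\in\mathcal T_\theta}I_\theta(\tau,\sigma)$, $\overline V(\theta)=\operatorname{ess\,inf}_{\sigma\in\mathcal T_\theta}\operatorname{ess\,sup}_{\tau\in\mathcal T_\theta}I_\theta(\tau,\sigma)$. The game is fair if $\underline V(\theta)=\overline V(\theta)$ a.s. for every $\theta$. *)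

theory Defs
  imports "HOL-Probability.Probability"
begin

type_synonym 'a stime = "'a \<Rightarrow> real"
type_synonym 'a family = "'a stime \<Rightarrow> 'a \<Rightarrow> ereal"

definition usual_filtration :: "'a measure \<Rightarrow> (real \<Rightarrow> 'a measure) \<Rightarrow> real \<Rightarrow> bool" where
  "usual_filtration M F T \<longleftrightarrow>
     (\<forall>t\<in>{0..T}. space (F t) = space M \<and> sets (F t) \<subseteq> sets M) \<and>
     (\<forall>s t. 0 \<le> s \<longrightarrow> s \<le> t \<longrightarrow> t \<le> T \<longrightarrow> sets (F s) \<subseteq> sets (F t)) \<and>
     (\<forall>t\<in>{0..<T}. sets (F t) = (\<Inter>s\<in>{t<..T}. sets (F s))) \<and>
     (\<forall>A B. A \<in> null_sets M \<longrightarrow> B \<subseteq> A \<longrightarrow> B \<in> sets M) \<and>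
     null_sets M \<subseteq> sets (F 0)"

definition stopping_time_T :: "'a measure \<Rightarrow> (real \<Rightarrow> 'a measure) \<Rightarrow> real \<Rightarrow> 'a stime \<Rightarrow> bool" where
  "stopping_time_T M F T \<theta> \<longleftrightarrow>
     (\<forall>\<omega>\<in>space M. 0 \<le> \<theta> \<omega> \<and> \<theta> \<omega> \<le> T) \<and>
     (\<forall>t\<in>{0..T}. {\<omega>\<in>space M. \<theta> \<omega> \<le> t} \<in> sets (F t))"

definition ST :: "'a measure \<Rightarrow> (real \<Rightarrow> 'a measure) \<Rightarrow> real \<Rightarrow> 'a stime set" where
  "ST M F T = {\<theta>. stopping_time_T M F T \<theta>}"

definition ST_from :: "'a measure \<Rightarrow> (real \<Rightarrow> 'a measure) \<Rightarrow> real \<Rightarrow> 'a stime \<Rightarrow> 'a stime set" where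
  "ST_from M F T S = {\<theta>\<in>ST M F T. AE \<omega> in M. S \<omega> \<le> \<theta> \<omega>}"

definition F_st :: "'a measure \<Rightarrow> (real \<Rightarrow> 'a measure) \<Rightarrow> real \<Rightarrow> 'a stime \<Rightarrow> 'a measure" where
  "F_st M F T \<theta> = sigma (space M)
     {A \<in> sets M. \<forall>t\<in>{0..T}. A \<inter> {\<omega>\<in>space M. \<theta> \<omega> \<le> t} \<in> sets (F t)}"

definition is_esssup :: "'a measure \<Rightarrow> 'i set \<Rightarrow> ('i \<Rightarrow> 'a \<Rightarrow> ereal) \<Rightarrow> ('a \<Rightarrow> ereal) \<Rightarrow> bool" where
  "is_esssup M I X Z \<longleftrightarrow> Z \<in> borel_measurable M \<and>
     (\<forall>i\<in>I. AE \<omega> in M. X i \<omega> \<le> Z \<omega>) \<and>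
     (\<forall>Z'\<in>borel_measurable M. (\<forall>i\<in>I. AE \<omega> in M. X i \<omega> \<le> Z' \<omega>) \<longrightarrow> (AE \<omega> in M. Z \<omega> \<le> Z' \<omega>))"

definition is_essinf :: "'a measure \<Rightarrow> 'i set \<Rightarrow> ('i \<Rightarrow> 'a \<Rightarrow> ereal) \<Rightarrow> ('a \<Rightarrow> ereal) \<Rightarrow> bool" where
  "is_essinf M I X Z \<longleftrightarrow> Z \<in> borel_measurable M \<and>
     (\<forall>i\<in>I. AE \<omega> in M. Z \<omega> \<le> X i \<omega>) \<and>
     (\<forall>Z'\<in>borel_measurable M. (\<forall>i\<in>I. AE \<omega> in M. Z' \<omega> \<le> X i \<omega>) \<longrightarrow> (AE \<omega> in M. Z' \<omega> \<le> Z \<omega>))"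

definition esssupF :: "'a measure \<Rightarrow> 'i set \<Rightarrow> ('i \<Rightarrow> 'a \<Rightarrow> ereal) \<Rightarrow> 'a \<Rightarrow> ereal" where
  "esssupF M I X = (SOME Z. is_esssup M I X Z)"

definition essinfF :: "'a measure \<Rightarrow> 'i set \<Rightarrow> ('i \<Rightarrow> 'a \<Rightarrow> ereal) \<Rightarrow> 'a \<Rightarrow> ereal" where
  "essinfF M I X = (SOME Z. is_essinf M I X Z)"

definition eexp :: "'a measure \<Rightarrow> ('a \<Rightarrow> ereal) \<Rightarrow> ereal" where
  "eexp M X = enn2ereal (\<integral>\<^sup>+ \<omega>. e2ennreal (X \<omega>) \<partial>M) - enn2ereal (\<integral>\<^sup>+ \<omega>. e2ennreal (- X \<omega>) \<partial>M)"

definition ecexp :: "'a measure \<Rightarrow> 'a measure \<Rightarrow> ('a \<Rightarrow> ereal) \<Rightarrow> 'a \<Rightarrow> ereal" where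
  "ecexp M G X = (\<lambda>\<omega>. enn2ereal (nn_cond_exp M G (\<lambda>x. e2ennreal (X x)) \<omega>)
                      - enn2ereal (nn_cond_exp M G (\<lambda>x. e2ennreal (- X x)) \<omega>))"

definition admissible :: "'a measure \<Rightarrow> (real \<Rightarrow> 'a measure) \<Rightarrow> real \<Rightarrow> 'a family \<Rightarrow> bool" where
  "admissible M F T \<phi> \<longleftrightarrow>
     (\<forall>\<theta>\<in>ST M F T. \<phi> \<theta> \<in> borel_measurable (F_st M F T \<theta>)) \<and>
     (\<forall>\<theta>\<in>ST M F T. \<forall>\<theta>'\<in>ST M F T. AE \<omega> in M. \<theta> \<omega> = \<theta>' \<omega> \<longrightarrow> \<phi> \<theta> \<omega> = \<phi> \<theta>' \<omega>)"

definition right_USCE :: "'a measure \<Rightarrow> (real \<Rightarrow> 'a measure) \<Rightarrow> real \<Rightarrow> 'a family \<Rightarrow> bool" where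
  "right_USCE M F T \<phi> \<longleftrightarrow>
     admissible M F T \<phi> \<and>
     (\<integral>\<^sup>+ \<omega>. e2ennreal (esssupF M (ST M F T) (\<lambda>\<theta> \<omega>. max 0 (- \<phi> \<theta> \<omega>)) \<omega>) \<partial>M) < \<infinity> \<and>
     (\<forall>\<theta>\<in>ST M F T. \<forall>\<theta>s. (\<forall>n. \<theta>s n \<in> ST M F T) \<and>
          (AE \<omega> in M. decseq (\<lambda>n. \<theta>s n \<omega>) \<and> (\<lambda>n. \<theta>s n \<omega>) \<longlonglongrightarrow> \<theta> \<omega>)
        \<longrightarrow> limsup (\<lambda>n. eexp M (\<phi> (\<theta>s n))) \<le> eexp M (\<phi> \<theta>))"

primrec JJ :: "'a measure \<Rightarrow> (real \<Rightarrow> 'a measure) \<Rightarrow> real \<Rightarrow> 'a family \<Rightarrow> 'a family \<Rightarrow> nat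
    \<Rightarrow> 'a family \<times> 'a family" where
  "JJ M F T \<xi> \<zeta> 0 = ((\<lambda>\<theta> \<omega>. 0), (\<lambda>\<theta> \<omega>. 0))"
| "JJ M F T \<xi> \<zeta> (Suc n) =
     ((\<lambda>\<theta>. esssupF M (ST_from M F T \<theta>)
              (\<lambda>\<tau>. ecexp M (F_st M F T \<theta>) (\<lambda>\<omega>. snd (JJ M F T \<xi> \<zeta> n) \<tau> \<omega> + \<xi> \<tau> \<omega>))),
      (\<lambda>\<theta>. esssupF M (ST_from M F T \<theta>)
              (\<lambda>\<sigma>. ecexp M (F_st M F T \<theta>) (\<lambda>\<omega>. fst (JJ M F T \<xi> \<zeta> n) \<sigma> \<omega> - \<zeta> \<sigma> \<omega>))))"

definition Jn :: "'a measure \<Rightarrow> (real \<Rightarrow> 'a measure) \<Rightarrow> real \<Rightarrow> 'a family \<Rightarrow> 'a family \<Rightarrow> nat \<Rightarrow> 'a family" where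
  "Jn M F T \<xi> \<zeta> n = fst (JJ M F T \<xi> \<zeta> n)"

definition J'n :: "'a measure \<Rightarrow> (real \<Rightarrow> 'a measure) \<Rightarrow> real \<Rightarrow> 'a family \<Rightarrow> 'a family \<Rightarrow> nat \<Rightarrow> 'a family" where
  "J'n M F T \<xi> \<zeta> n = snd (JJ M F T \<xi> \<zeta> n)"

definition Jfam :: "'a measure \<Rightarrow> (real \<Rightarrow> 'a measure) \<Rightarrow> real \<Rightarrow> 'a family \<Rightarrow> 'a family \<Rightarrow> 'a family" where
  "Jfam M F T \<xi> \<zeta> = (\<lambda>\<theta> \<omega>. limsup (\<lambda>n. Jn M F T \<xi> \<zeta> n \<theta> \<omega>))"

definition J'fam :: "'a measure \<Rightarrow> (real \<Rightarrow> 'a measure) \<Rightarrow> real \<Rightarrow> 'a family \<Rightarrow> 'a family \<Rightarrow> 'a family" where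
  "J'fam M F T \<xi> \<zeta> = (\<lambda>\<theta> \<omega>. limsup (\<lambda>n. J'n M F T \<xi> \<zeta> n \<theta> \<omega>))"

definition Yfam :: "'a measure \<Rightarrow> (real \<Rightarrow> 'a measure) \<Rightarrow> real \<Rightarrow> 'a family \<Rightarrow> 'a family \<Rightarrow> 'a family" where
  "Yfam M F T \<xi> \<zeta> = (\<lambda>\<theta> \<omega>. Jfam M F T \<xi> \<zeta> \<theta> \<omega> - J'fam M F T \<xi> \<zeta> \<theta> \<omega>)"

definition Icrit :: "'a measure \<Rightarrow> (real \<Rightarrow> 'a measure) \<Rightarrow> real \<Rightarrow> 'a family \<Rightarrow> 'a family
    \<Rightarrow> 'a stime \<Rightarrow> 'a stime \<Rightarrow> 'a stime \<Rightarrow> 'a \<Rightarrow> ereal" where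
  "Icrit M F T \<xi> \<zeta> \<theta> \<tau> \<sigma> =
     ecexp M (F_st M F T \<theta>) (\<lambda>\<omega>. if \<tau> \<omega> \<le> \<sigma> \<omega> then \<xi> \<tau> \<omega> else \<zeta> \<sigma> \<omega>)"

definition V_lower :: "'a measure \<Rightarrow> (real \<Rightarrow> 'a measure) \<Rightarrow> real \<Rightarrow> 'a family \<Rightarrow> 'a family \<Rightarrow> 'a family" where
  "V_lower M F T \<xi> \<zeta> = (\<lambda>\<theta>. esssupF M (ST_from M F T \<theta>)
      (\<lambda>\<tau>. essinfF M (ST_from M F T \<theta>) (\<lambda>\<sigma>. Icrit M F T \<xi> \<zeta> \<theta> \<tau> \<sigma>)))"

definition V_upper :: "'a measure \<Rightarrow> (real \<Rightarrow> 'a measure) \<Rightarrow> real \<Rightarrow> 'a family \<Rightarrow> 'a family \<Rightarrow> 'a family" where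
  "V_upper M F T \<xi> \<zeta> = (\<lambda>\<theta>. essinfF M (ST_from M F T \<theta>)
      (\<lambda>\<sigma>. esssupF M (ST_from M F T \<theta>) (\<lambda>\<tau>. Icrit M F T \<xi> \<zeta> \<theta> \<tau> \<sigma>)))"

end

theory Submission
  imports Defs
begin

text \<open>
  The families \<open>J\<close> and \<open>J'\<close> are increasing limits of Snell envelopes, so by monotone convergence
  \<open>J\<close> is the Snell envelope of \<open>J' + \<xi>\<close> and \<open>J'\<close> that of \<open>J - \<zeta>\<close>; as \<open>F 0\<close> is trivial,
  finiteness of \<open>J(0)\<close> makes all these variables integrable. Choose \<open>\<tau>\<close> to be \<open>\<epsilon>\<close>-optimal for the
  stopping problem of \<open>J(\<theta>)\<close>, let \<open>\<sigma>\<close> be arbitrary and put \<open>\<rho> = min \<tau> \<sigma>\<close>. With \<open>Z\<close> the payoff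
  of the game, domination gives pointwise
  \<open>J'(\<tau>) + \<xi>(\<tau>) + J(\<rho>) \<le> Z + J'(\<rho>) + J(\<tau>)\<close>.
  Taking conditional expectations and using that \<open>J\<close> and \<open>J'\<close> are supermartingales yields
  \<open>J(\<theta>) - \<epsilon> \<le> I(\<tau>, \<sigma>) + J'(\<theta>)\<close>. An \<open>\<epsilon>\<close>-optimal \<open>\<sigma>\<close> for \<open>J'(\<theta>)\<close> gives the opposite bound
  in the same way.
\<close>

subsection \<open>Essential suprema\<close>

text \<open>Infinite values shape the argument. Only one-sided integrability is available at the
  start, so conditional expectations are handled for variables with integrable negative part,
  inequalities are kept as sums, and a term is cancelled only once it is known to be finite.
  Integrability of \<open>J\<close> is itself drawn from the supermartingale inequality started at
  time 0; that inequality must therefore be proved for envelopes that might be infinite, which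
  forces truncation and monotone limits. The negative part of \<open>\<zeta>\<close> is controlled
  only later, through \<open>J'\<close>.

  Null sets are the second obstacle. An essential supremum is fixed only almost everywhere, and an
  envelope consists of versions chosen separately for each stopping time. Their agreement on
  \<open>{\<theta> = \<theta>'}\<close> is proved by pasting stopping times and by comparing
  conditional expectations under two sigma-algebras with the same trace on an event. Pasting along a
  countable set of competitors also yields the near-optimal times.\<close>

definition ereal_squash :: "ereal \<Rightarrow> real" where
  "ereal_squash x = (if x = \<infinity> then 4 else if x = -\<infinity> then 0 else arctan (real_of_ereal x) + 2)"

lemma measurable_ereal_squash [measurable]: "ereal_squash \<in> borel_measurable borel"
  unfolding ereal_squash_def by measurable

text \<open>Since pi/2 < 2, the offset 2 puts the values at real arguments strictly between 0 and 4,
  and the two endpoints are left for the infinite arguments.\<close>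

lemma ereal_squash_bounds: "0 \<le> ereal_squash x" "ereal_squash x \<le> 4"
proof -
  have "- (pi/2) < arctan (real_of_ereal x)" "arctan (real_of_ereal x) < pi/2"
    by (rule arctan_lbound arctan_ubound)+
  moreover have "pi / 2 < 2" using pi_half_less_two by simp
  ultimately show "0 \<le> ereal_squash x" "ereal_squash x \<le> 4"
    unfolding ereal_squash_def by auto
qed

lemma strict_mono_ereal_squash: "strict_mono ereal_squash"
proof (rule strict_monoI)
  fix x y :: ereal assume "x < y"
  have "- (pi/2) < arctan r" "arctan r < pi/2" for r
    by (rule arctan_lbound arctan_ubound)+
  moreover have "pi / 2 < 2" using pi_half_less_two by simp
  ultimately have b: "-2 < arctan r" "arctan r < 2" for r
    by (meson less_trans minus_less_iff neg_less_iff_less order.strict_trans)+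
  show "ereal_squash x < ereal_squash y"
    using \<open>x < y\<close> b[of "real_of_ereal x"] b[of "real_of_ereal y"]
    by (cases x; cases y) (auto simp: ereal_squash_def arctan_monotone)
qed

text \<open>The countable index set is chosen to maximise the integral of a bounded strictly
  increasing function of the supremum; a further index cannot increase that integral.\<close>

lemma (in finite_measure) esssup_countable:
  fixes X :: "'i \<Rightarrow> 'a \<Rightarrow> ereal"
  assumes X [measurable]: "\<And>i. i \<in> I \<Longrightarrow> X i \<in> borel_measurable M"
  obtains C where "C \<subseteq> I" "countable C"
    "\<And>i. i \<in> I \<Longrightarrow> AE \<omega> in M. X i \<omega> \<le> (SUP j\<in>C. X j \<omega>)"
proof -
  let ?S = "\<lambda>C \<omega>. SUP j\<in>C. X j \<omega>"
  let ?\<Phi> = "\<lambda>C. \<integral>\<^sup>+ \<omega>. ennreal (ereal_squash (?S C \<omega>)) \<partial>M"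
  let ?A = "{C. C \<subseteq> I \<and> countable C}"
  have Smeas: "?S C \<in> borel_measurable M" if "C \<in> ?A" for C
    using that by (auto intro!: borel_measurable_SUP X)
  have mono: "?\<Phi> C \<le> ?\<Phi> D" if "C \<subseteq> D" for C D
    by (intro nn_integral_mono ennreal_leI strict_mono_leD[OF strict_mono_ereal_squash] SUP_subset_mono that order_refl)
  have "?A \<noteq> {}" by auto
  from ennreal_SUP_countable_SUP[OF this, of ?\<Phi>] obtain f :: "nat \<Rightarrow> ennreal"
    where f: "range f \<subseteq> ?\<Phi> ` ?A" "Sup (?\<Phi> ` ?A) = Sup (range f)" by auto
  have "\<forall>n. \<exists>C. C \<in> ?A \<and> f n = ?\<Phi> C"
  proof
    fix n
    have "f n \<in> ?\<Phi> ` ?A" using f(1) by (rule subsetD) (rule rangeI)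
    then show "\<exists>C. C \<in> ?A \<and> f n = ?\<Phi> C" by (rule imageE) blast
  qed
  then obtain Cs where Cs: "\<And>n. Cs n \<in> ?A" "\<And>n. f n = ?\<Phi> (Cs n)"
    by metis
  \<comment> \<open>The union of a maximising sequence of countable sets is again countable, so the
    supremum of \<open>?\<Phi>\<close> is attained.\<close>
  define C where "C = (\<Union>n. Cs n)"
  have C: "C \<in> ?A" using Cs(1) unfolding C_def by auto
  have max: "?\<Phi> D \<le> ?\<Phi> C" if "D \<in> ?A" for D
  proof -
    have "?\<Phi> D \<le> Sup (range f)"
      unfolding f(2)[symmetric] using that by (rule SUP_upper)
    also have "\<dots> \<le> ?\<Phi> C"
      unfolding Cs(2) by (intro SUP_least mono) (auto simp: C_def)
    finally show ?thesis .
  qed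
  show thesis
  proof (rule that[of C])
    fix i assume i: "i \<in> I"
    let ?D = "insert i C"
    have D: "?D \<in> ?A" using C i by auto
    note [measurable] = Smeas[OF C] Smeas[OF D]
    have int: "integrable M (\<lambda>\<omega>. ereal_squash (?S E \<omega>))" if "E \<in> ?A" for E
      using Smeas[OF that] ereal_squash_bounds
      by (intro integrable_const_bound[of _ 4]) auto
    have "?\<Phi> ?D = ?\<Phi> C"
      by (intro antisym max[OF D] mono) auto
    then have eq: "(\<integral>\<omega>. ereal_squash (?S C \<omega>) \<partial>M) = (\<integral>\<omega>. ereal_squash (?S ?D \<omega>) \<partial>M)"
      using nn_integral_eq_integral[OF int[OF C]] nn_integral_eq_integral[OF int[OF D]]
      by (simp add: ereal_squash_bounds integral_nonneg)
    \<comment> \<open>Two pointwise ordered functions with the same finite integral agree almost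
      everywhere; injectivity then removes the squashing.\<close>
    have "AE \<omega> in M. ereal_squash (?S C \<omega>) = ereal_squash (?S ?D \<omega>)"
      by (rule integral_ineq_eq_0_then_AE[OF _ int[OF C] int[OF D] eq])
         (auto intro!: strict_mono_leD[OF strict_mono_ereal_squash] SUP_subset_mono)
    then show "AE \<omega> in M. X i \<omega> \<le> ?S C \<omega>"
    proof eventually_elim
      case (elim \<omega>)
      then have "?S C \<omega> = ?S ?D \<omega>"
        using strict_mono_eq[OF strict_mono_ereal_squash] by blast
      then show ?case by (metis SUP_upper insertI1)
    qed
  qed (use C in auto)
qed

text \<open>\<open>esssupF\<close> is a choice term, so nothing is known about it until some
  essential supremum exists; a countable pointwise supremum is a witness.\<close>

lemma (in finite_measure) is_esssup_esssupF:
  assumes "\<And>i. i \<in> I \<Longrightarrow> X i \<in> borel_measurable M"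
  shows "is_esssup M I X (esssupF M I X)"
proof -
  obtain C where C: "C \<subseteq> I" "countable C"
    "\<And>i. i \<in> I \<Longrightarrow> AE \<omega> in M. X i \<omega> \<le> (SUP j\<in>C. X j \<omega>)"
    using esssup_countable[of I X] assms by metis
  have "is_esssup M I X (\<lambda>\<omega>. SUP j\<in>C. X j \<omega>)"
    unfolding is_esssup_def
  proof (intro conjI ballI impI)
    show "(\<lambda>\<omega>. SUP j\<in>C. X j \<omega>) \<in> borel_measurable M"
      using C assms by (auto intro!: borel_measurable_SUP)
    fix Z' assume "\<forall>i\<in>I. AE \<omega> in M. X i \<omega> \<le> Z' \<omega>"
    then have "AE \<omega> in M. \<forall>j\<in>C. X j \<omega> \<le> Z' \<omega>"
      using C by (subst AE_ball_countable) auto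
    then show "AE \<omega> in M. (SUP j\<in>C. X j \<omega>) \<le> Z' \<omega>"
      by eventually_elim (auto intro: SUP_least)
  qed (use C in auto)
  then show ?thesis unfolding esssupF_def by (rule someI[of "is_esssup M I X"])
qed

text \<open>The countable representation serves two ends: it inherits measurability with respect to
  a smaller sigma-algebra, and it reduces the search for near-maximisers to a sequence.\<close>

lemma (in finite_measure) is_esssup_countable:
  assumes "is_esssup M I X Z" "\<And>i. i \<in> I \<Longrightarrow> X i \<in> borel_measurable M"
  obtains C where "C \<subseteq> I" "countable C" "AE \<omega> in M. Z \<omega> = (SUP j\<in>C. X j \<omega>)"
proof -
  obtain C where C: "C \<subseteq> I" "countable C"
    "\<And>i. i \<in> I \<Longrightarrow> AE \<omega> in M. X i \<omega> \<le> (SUP j\<in>C. X j \<omega>)"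
    using esssup_countable[of I X] assms(2) by metis
  have "AE \<omega> in M. Z \<omega> \<le> (SUP j\<in>C. X j \<omega>)"
  proof -
    have "(\<lambda>\<omega>. SUP j\<in>C. X j \<omega>) \<in> borel_measurable M"
      using assms C by (auto intro!: borel_measurable_SUP)
    moreover have "\<forall>i\<in>I. AE \<omega> in M. X i \<omega> \<le> (SUP j\<in>C. X j \<omega>)"
      using C(3) by simp
    ultimately show ?thesis using assms(1) unfolding is_esssup_def
      by (elim conjE ballE[where x = "\<lambda>\<omega>. SUP j\<in>C. X j \<omega>"]) simp_all
  qed
  moreover have "AE \<omega> in M. \<forall>j\<in>C. X j \<omega> \<le> Z \<omega>"
    using C assms(1) by (subst AE_ball_countable) (auto simp: is_esssup_def)
  ultimately have "AE \<omega> in M. Z \<omega> = (SUP j\<in>C. X j \<omega>)"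
    by eventually_elim (auto intro!: antisym SUP_least)
  with C show thesis by (intro that)
qed

lemma is_essinf_iff_is_esssup_uminus:
  "is_essinf M I X Z \<longleftrightarrow> is_esssup M I (\<lambda>i \<omega>. - X i \<omega>) (\<lambda>\<omega>. - Z \<omega>)"
proof -
  \<comment> \<open>Negation is an involution of the test functions, so minimality and maximality
    can be exchanged.\<close>
  have *: "(\<forall>Z'\<in>borel_measurable M. P Z') \<longleftrightarrow> (\<forall>Z'\<in>borel_measurable M. P (\<lambda>\<omega>. - Z' \<omega>))"
    for P :: "('a \<Rightarrow> ereal) \<Rightarrow> bool"
  proof (intro iffI ballI)
    fix Z' :: "'a \<Rightarrow> ereal"
    assume "\<forall>Z'\<in>borel_measurable M. P (\<lambda>\<omega>. - Z' \<omega>)" "Z' \<in> borel_measurable M"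
    then have "P (\<lambda>\<omega>. - (- Z' \<omega>))" by (metis borel_measurable_uminus_ereal)
    then show "P Z'" by simp
  qed auto
  show ?thesis
    unfolding is_essinf_def is_esssup_def
    by (subst (2) *) simp
qed

lemma (in finite_measure) is_essinf_essinfF:
  assumes "\<And>i. i \<in> I \<Longrightarrow> X i \<in> borel_measurable M"
  shows "is_essinf M I X (essinfF M I X)"
proof -
  have "is_esssup M I (\<lambda>i \<omega>. - X i \<omega>) (esssupF M I (\<lambda>i \<omega>. - X i \<omega>))"
    using assms by (intro is_esssup_esssupF) auto
  then have "is_essinf M I X (\<lambda>\<omega>. - esssupF M I (\<lambda>i \<omega>. - X i \<omega>) \<omega>)"
    by (simp add: is_essinf_iff_is_esssup_uminus)
  then show ?thesis unfolding essinfF_def by (rule someI[of "is_essinf M I X"])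
qed

subsection \<open>Conditional expectations of extended real random variables\<close>

text \<open>\<open>e2ennreal\<close> sends negative values to 0, so the integrand is the negative
  part of \<open>X\<close>. The class contains every nonnegative measurable variable, even an
  infinite one, is closed under sums, and keeps the subtrahend in \<open>ecexp\<close> finite almost
  everywhere.\<close>

definition lower_integrable :: "'a measure \<Rightarrow> ('a \<Rightarrow> ereal) \<Rightarrow> bool" where
  "lower_integrable M X \<longleftrightarrow> X \<in> borel_measurable M \<and> (\<integral>\<^sup>+ \<omega>. e2ennreal (- X \<omega>) \<partial>M) < \<infinity>"

lemma lower_integrable_measurable [measurable_dest]:
  "lower_integrable M X \<Longrightarrow> X \<in> borel_measurable M"
  by (simp add: lower_integrable_def)

lemma lower_integrable_nonneg:
  assumes "X \<in> borel_measurable M" "AE \<omega> in M. 0 \<le> X \<omega>"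
  shows "lower_integrable M X"
proof -
  have "(\<integral>\<^sup>+ \<omega>. e2ennreal (- X \<omega>) \<partial>M) = (\<integral>\<^sup>+ \<omega>. 0 \<partial>M)"
    using assms(2) by (intro nn_integral_cong_AE) (auto simp: e2ennreal_neg)
  then show ?thesis using assms by (simp add: lower_integrable_def)
qed

lemma lower_integrable_AE_mono:
  assumes "lower_integrable M X" "Y \<in> borel_measurable M" "AE \<omega> in M. X \<omega> \<le> Y \<omega>"
  shows "lower_integrable M Y"
proof -
  have "(\<integral>\<^sup>+ \<omega>. e2ennreal (- Y \<omega>) \<partial>M) \<le> (\<integral>\<^sup>+ \<omega>. e2ennreal (- X \<omega>) \<partial>M)"
    using assms(3) by (intro nn_integral_mono_AE, elim eventually_mono) (simp add: e2ennreal_mono)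
  then show ?thesis using assms by (auto simp: lower_integrable_def)
qed

lemma lower_integrable_AE_finite:
  assumes "lower_integrable M X"
  shows "AE \<omega> in M. X \<omega> \<noteq> -\<infinity>"
proof -
  have "AE \<omega> in M. e2ennreal (- X \<omega>) \<noteq> \<infinity>"
    using assms by (intro nn_integral_PInf_AE) (auto simp: lower_integrable_def)
  then show ?thesis by eventually_elim auto
qed

lemma e2ennreal_add_le: "e2ennreal (x + y) \<le> e2ennreal x + e2ennreal y"
proof (cases x; cases y)
  fix r s assume "x = ereal r" "y = ereal s"
  then show ?thesis
    by (simp add: ennreal_plus_if) (auto intro!: ennreal_leI simp: ennreal_neg)
qed (auto simp: e2ennreal_neg)

lemma lower_integrable_add:
  assumes X: "lower_integrable M X" and Y: "lower_integrable M Y"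
  shows "lower_integrable M (\<lambda>\<omega>. X \<omega> + Y \<omega>)"
proof -
  note [measurable] = X[THEN lower_integrable_measurable] Y[THEN lower_integrable_measurable]
  have "(\<integral>\<^sup>+ \<omega>. e2ennreal (- (X \<omega> + Y \<omega>)) \<partial>M)
      \<le> (\<integral>\<^sup>+ \<omega>. e2ennreal (- X \<omega>) + e2ennreal (- Y \<omega>) \<partial>M)"
    using lower_integrable_AE_finite[OF X] lower_integrable_AE_finite[OF Y]
  proof (intro nn_integral_mono_AE, eventually_elim)
    case (elim \<omega>)
    then have "- (X \<omega> + Y \<omega>) = - X \<omega> + - Y \<omega>"
      by (cases "X \<omega>"; cases "Y \<omega>") auto
    then show ?case by (simp add: e2ennreal_add_le)
  qed
  also have "\<dots> = (\<integral>\<^sup>+ \<omega>. e2ennreal (- X \<omega>) \<partial>M) + (\<integral>\<^sup>+ \<omega>. e2ennreal (- Y \<omega>) \<partial>M)"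
    by (intro nn_integral_add) auto
  also have "\<dots> < \<infinity>"
    using X Y by (auto simp: lower_integrable_def)
  finally show ?thesis by (simp add: lower_integrable_def)
qed

text \<open>The arithmetic behind additivity of \<open>ecexp\<close>: \<open>s\<close> and
  \<open>c\<close> stand for the positive and negative part of a sum, \<open>x\<close>,
  \<open>a\<close> and \<open>y\<close>, \<open>b\<close> for those of its summands. Only the
  subtracted quantities must be finite.\<close>

lemma ereal_diff_eq_diff_add_diff:
  fixes s x y a b c :: ereal
  assumes "s + (a + b) = c + (x + y)" "a \<noteq> \<infinity>" "b \<noteq> \<infinity>" "c \<noteq> \<infinity>"
    "0 \<le> s" "0 \<le> x" "0 \<le> y" "0 \<le> a" "0 \<le> b" "0 \<le> c"
  shows "s - c = (x - a) + (y - b)"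
proof -
  obtain a' b' c' where "a = ereal a'" "b = ereal b'" "c = ereal c'"
    using assms by (metis MInfty_neq_PInfty(1) ereal_cases ereal_infty_less_eq(2) ereal_less_eq(2) zero_ereal_def ereal.distinct(5))
  then show ?thesis using assms(1,5-7)
    by (cases s; cases x; cases y) auto
qed

context sigma_finite_subalgebra
begin

lemma measurable_ecexp: "ecexp M F X \<in> borel_measurable F"
  unfolding ecexp_def by measurable

lemma measurable_ecexp' [measurable]: "ecexp M F X \<in> borel_measurable M"
  by (rule measurable_from_subalg[OF subalg measurable_ecexp])

lemma ecexp_mono:
  assumes [measurable]: "X \<in> borel_measurable M" "Y \<in> borel_measurable M"
    and le: "AE \<omega> in M. X \<omega> \<le> Y \<omega>"
  shows "AE \<omega> in M. ecexp M F X \<omega> \<le> ecexp M F Y \<omega>"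
proof -
  have "AE \<omega> in M. nn_cond_exp M F (\<lambda>x. e2ennreal (X x)) \<omega> \<le> nn_cond_exp M F (\<lambda>x. e2ennreal (Y x)) \<omega>"
    using le by (intro nn_cond_exp_mono, elim eventually_mono) (simp_all add: e2ennreal_mono)
  moreover have "AE \<omega> in M. nn_cond_exp M F (\<lambda>x. e2ennreal (- Y x)) \<omega> \<le> nn_cond_exp M F (\<lambda>x. e2ennreal (- X x)) \<omega>"
    using le by (intro nn_cond_exp_mono, elim eventually_mono) (simp_all add: e2ennreal_mono)
  ultimately show ?thesis
    by eventually_elim (auto simp: ecexp_def less_eq_ennreal.rep_eq intro: ereal_minus_mono)
qed

lemma nn_cond_exp_finite:
  assumes [measurable]: "f \<in> borel_measurable M" and "(\<integral>\<^sup>+ \<omega>. f \<omega> \<partial>M) < \<infinity>"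
  shows "AE \<omega> in M. nn_cond_exp M F f \<omega> < \<infinity>"
proof -
  have "(\<integral>\<^sup>+ \<omega>. nn_cond_exp M F f \<omega> \<partial>M) = (\<integral>\<^sup>+ \<omega>. f \<omega> \<partial>M)"
    using nn_cond_exp_intg[of "\<lambda>_. 1" f] by simp
  then have "AE \<omega> in M. nn_cond_exp M F f \<omega> \<noteq> \<infinity>"
    using assms by (intro nn_integral_PInf_AE) auto
  then show ?thesis by eventually_elim (simp add: less_top)
qed

lemma ecexp_nonneg:
  assumes [measurable]: "X \<in> borel_measurable M" and "AE \<omega> in M. 0 \<le> X \<omega>"
  shows "AE \<omega> in M. ecexp M F X \<omega> = enn2ereal (nn_cond_exp M F (\<lambda>x. e2ennreal (X x)) \<omega>)"
proof -
  have "AE \<omega> in M. nn_cond_exp M F (\<lambda>x. e2ennreal (- X x)) \<omega> = nn_cond_exp M F (\<lambda>x. 0) \<omega>"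
    using assms(2) by (intro nn_cond_exp_cong) (auto simp: e2ennreal_neg)
  moreover have "AE \<omega> in M. 0 = nn_cond_exp M F (\<lambda>x. 0) \<omega>"
    by (rule nn_cond_exp_F_meas) simp
  ultimately show ?thesis
    by eventually_elim (simp add: ecexp_def zero_ennreal.rep_eq)
qed

lemma ecexp_uminus_nonneg:
  assumes [measurable]: "X \<in> borel_measurable M" and "AE \<omega> in M. 0 \<le> X \<omega>"
  shows "AE \<omega> in M. ecexp M F (\<lambda>x. - X x) \<omega> = - enn2ereal (nn_cond_exp M F (\<lambda>x. e2ennreal (X x)) \<omega>)"
proof -
  have "AE \<omega> in M. nn_cond_exp M F (\<lambda>x. e2ennreal (- X x)) \<omega> = nn_cond_exp M F (\<lambda>x. 0) \<omega>"
    using assms(2) by (intro nn_cond_exp_cong) (auto simp: e2ennreal_neg)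
  moreover have "AE \<omega> in M. 0 = nn_cond_exp M F (\<lambda>x. 0) \<omega>"
    by (rule nn_cond_exp_F_meas) simp
  ultimately show ?thesis
    by eventually_elim (simp add: ecexp_def zero_ennreal.rep_eq)
qed

lemma ecexp_F_meas:
  assumes [measurable]: "X \<in> borel_measurable F"
  shows "AE \<omega> in M. ecexp M F X \<omega> = X \<omega>"
proof -
  have "AE \<omega> in M. e2ennreal (X \<omega>) = nn_cond_exp M F (\<lambda>x. e2ennreal (X x)) \<omega>"
       "AE \<omega> in M. e2ennreal (- X \<omega>) = nn_cond_exp M F (\<lambda>x. e2ennreal (- X x)) \<omega>"
    by (intro nn_cond_exp_F_meas; measurable)+
  then show ?thesis
  proof eventually_elim
    case (elim \<omega>)
    have "enn2ereal (e2ennreal (X \<omega>)) - enn2ereal (e2ennreal (- X \<omega>)) = X \<omega>"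
      by (cases "0 \<le> X \<omega>") (auto simp: enn2ereal_e2ennreal e2ennreal_neg zero_ennreal.rep_eq)
    then show ?case using elim by (simp add: ecexp_def)
  qed
qed

lemma ecexp_add:
  assumes X: "lower_integrable M X" and Y: "lower_integrable M Y"
  shows "AE \<omega> in M. ecexp M F (\<lambda>x. X x + Y x) \<omega> = ecexp M F X \<omega> + ecexp M F Y \<omega>"
proof -
  note [measurable] = X[THEN lower_integrable_measurable] Y[THEN lower_integrable_measurable]
  note S = lower_integrable_add[OF X Y]
  let ?N = "nn_cond_exp M F"
  let ?xp = "\<lambda>x. e2ennreal (X x)" and ?xm = "\<lambda>x. e2ennreal (- X x)"
  let ?yp = "\<lambda>x. e2ennreal (Y x)" and ?ym = "\<lambda>x. e2ennreal (- Y x)"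
  let ?sp = "\<lambda>x. e2ennreal (X x + Y x)" and ?sm = "\<lambda>x. e2ennreal (- (X x + Y x))"
  \<comment> \<open>With every negative part moved to the other side, additivity of the parts
    becomes an identity between nonnegative functions. The conditional expectations of the three
    negative parts are finite, so they can be moved back afterwards.\<close>
  have "AE x in M. ?sp x + (?xm x + ?ym x) = ?sm x + (?xp x + ?yp x)"
    using lower_integrable_AE_finite[OF X] lower_integrable_AE_finite[OF Y]
  proof eventually_elim
    case (elim x)
    then show ?case
    proof (cases "X x"; cases "Y x")
      fix r s assume rs: "X x = ereal r" "Y x = ereal s"
      show ?thesis unfolding rs
        by (auto simp: ennreal_plus_if ennreal_neg max_def)
    qed auto
  qed
  then have "AE x in M. ?N (\<lambda>x. ?sp x + (?xm x + ?ym x)) x = ?N (\<lambda>x. ?sm x + (?xp x + ?yp x)) x"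
    by (intro nn_cond_exp_cong) auto
  moreover have "AE x in M. ?N ?sp x + ?N (\<lambda>x. ?xm x + ?ym x) x = ?N (\<lambda>x. ?sp x + (?xm x + ?ym x)) x"
    "AE x in M. ?N ?sm x + ?N (\<lambda>x. ?xp x + ?yp x) x = ?N (\<lambda>x. ?sm x + (?xp x + ?yp x)) x"
    "AE x in M. ?N ?xm x + ?N ?ym x = ?N (\<lambda>x. ?xm x + ?ym x) x"
    "AE x in M. ?N ?xp x + ?N ?yp x = ?N (\<lambda>x. ?xp x + ?yp x) x"
    by (intro nn_cond_exp_sum; measurable)+
  moreover have "AE x in M. ?N ?xm x < \<infinity>" "AE x in M. ?N ?ym x < \<infinity>" "AE x in M. ?N ?sm x < \<infinity>"
    using X Y S by (intro nn_cond_exp_finite; auto simp: lower_integrable_def)+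
  ultimately show ?thesis
  proof eventually_elim
    case (elim x)
    then have eq: "?N ?sp x + (?N ?xm x + ?N ?ym x) = ?N ?sm x + (?N ?xp x + ?N ?yp x)"
      by simp
    have "enn2ereal (?N ?sp x) + (enn2ereal (?N ?xm x) + enn2ereal (?N ?ym x))
        = enn2ereal (?N ?sm x) + (enn2ereal (?N ?xp x) + enn2ereal (?N ?yp x))"
      using arg_cong[OF eq, of enn2ereal] by (simp add: plus_ennreal.rep_eq)
    moreover have "enn2ereal (?N ?xm x) \<noteq> \<infinity>" "enn2ereal (?N ?ym x) \<noteq> \<infinity>" "enn2ereal (?N ?sm x) \<noteq> \<infinity>"
      using elim(6-8) by auto
    ultimately show ?case
      unfolding ecexp_def by (intro ereal_diff_eq_diff_add_diff) auto
  qed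
qed

text \<open>Monotone convergence gives both sides the same integral over every set of
  \<open>F\<close>, and these integrals characterise the conditional expectation.\<close>

lemma nn_cond_exp_SUP:
  fixes f :: "nat \<Rightarrow> 'a \<Rightarrow> ennreal"
  assumes [measurable]: "\<And>n. f n \<in> borel_measurable M"
    and mono: "\<And>n. AE x in M. f n x \<le> f (Suc n) x"
  shows "AE x in M. (SUP n. nn_cond_exp M F (f n) x) = nn_cond_exp M F (\<lambda>x. SUP n. f n x) x"
proof (rule nn_cond_exp_charact)
  fix A assume A [measurable]: "A \<in> sets F"
  have AM [measurable]: "A \<in> sets M" using A subalg by (auto simp: subalgebra_def)
  have mono': "AE x in M. nn_cond_exp M F (f n) x \<le> nn_cond_exp M F (f (Suc n)) x" for n
    using mono by (intro nn_cond_exp_mono) auto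
  have "(\<integral>\<^sup>+ x\<in>A. (SUP n. f n x) \<partial>M) = (\<integral>\<^sup>+ x. (SUP n. f n x * indicator A x) \<partial>M)"
    by (simp add: SUP_mult_right_ennreal)
  also have "\<dots> = (SUP n. \<integral>\<^sup>+ x\<in>A. f n x \<partial>M)"
    by (intro nn_integral_monotone_convergence_SUP_AE)
       (rule eventually_mono[OF mono], auto intro!: mult_right_mono)
  also have "\<dots> = (SUP n. \<integral>\<^sup>+ x\<in>A. nn_cond_exp M F (f n) x \<partial>M)"
    using nn_cond_exp_intg[of "indicator A"] by (simp add: mult.commute)
  also have "\<dots> = (\<integral>\<^sup>+ x. (SUP n. nn_cond_exp M F (f n) x * indicator A x) \<partial>M)"
    by (intro nn_integral_monotone_convergence_SUP_AE[symmetric])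
       (rule eventually_mono[OF mono'], auto intro!: mult_right_mono)
  also have "\<dots> = (\<integral>\<^sup>+ x\<in>A. (SUP n. nn_cond_exp M F (f n) x) \<partial>M)"
    by (simp add: SUP_mult_right_ennreal)
  finally show "(\<integral>\<^sup>+ x\<in>A. (SUP n. f n x) \<partial>M) = (\<integral>\<^sup>+ x\<in>A. (SUP n. nn_cond_exp M F (f n) x) \<partial>M)" .
qed auto

text \<open>Adding the integrable negative part of \<open>X 0\<close> makes the whole sequence
  nonnegative, so conditional monotone convergence applies; its conditional expectation is finite
  and is cancelled at the end. The conclusion is phrased as preservation of an upper bound
  \<open>Z\<close> because it is applied with an envelope as \<open>Z\<close>.\<close>

lemma ecexp_SUP_le:
  fixes X :: "nat \<Rightarrow> 'a \<Rightarrow> ereal"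
  assumes X: "\<And>n. lower_integrable M (X n)"
    and mono: "\<And>n. AE \<omega> in M. X n \<omega> \<le> X (Suc n) \<omega>"
    and Y: "Y \<in> borel_measurable M" "AE \<omega> in M. Y \<omega> = (SUP n. X n \<omega>)"
    and le: "\<And>n. AE \<omega> in M. ecexp M F (X n) \<omega> \<le> Z \<omega>"
  shows "AE \<omega> in M. ecexp M F Y \<omega> \<le> Z \<omega>"
proof -
  note [measurable] = X[THEN lower_integrable_measurable] Y(1)
  let ?N = "nn_cond_exp M F"
  let ?H = "\<lambda>x. e2ennreal (- X 0 x)"
  have Hfin: "(\<integral>\<^sup>+ x. ?H x \<partial>M) < \<infinity>" using X[of 0] by (simp add: lower_integrable_def)
  have li_H: "lower_integrable M (\<lambda>x. enn2ereal (?H x))"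
    by (intro lower_integrable_nonneg) auto
  have X0: "AE x in M. X 0 x \<le> X n x" for n
  proof (induction n)
    case (Suc n) with mono[of n] show ?case by eventually_elim auto
  qed auto
  have li_Y: "lower_integrable M Y"
    using Y(2) by (intro lower_integrable_AE_mono[OF X[of 0] Y(1)], elim eventually_mono) (auto intro: SUP_upper2[of 0])
  have nonneg: "AE x in M. 0 \<le> W x + enn2ereal (?H x)" if "AE x in M. X 0 x \<le> W x" for W
    using that lower_integrable_AE_finite[OF X[of 0]]
  proof eventually_elim
    case (elim x)
    show ?case
    proof (cases "0 \<le> X 0 x")
      case True then show ?thesis using elim by (meson add_nonneg_nonneg enn2ereal_nonneg order_trans)
    next
      case False
      then have "enn2ereal (?H x) = - X 0 x" by (intro enn2ereal_e2ennreal) (auto simp: ereal_0_le_uminus_iff)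
      then show ?thesis using elim by (cases "X 0 x"; cases "W x") auto
    qed
  qed
  \<comment> \<open>Dictionary between \<open>ecexp\<close> and \<open>nn_cond_exp\<close>, needed
    for each \<open>X n\<close> and for the limit \<open>Y\<close>.\<close>
  have shift: "AE x in M. ecexp M F W x + enn2ereal (?N ?H x) = enn2ereal (?N (\<lambda>x. e2ennreal (W x + enn2ereal (?H x))) x)"
    if W: "lower_integrable M W" "AE x in M. X 0 x \<le> W x" for W
  proof -
    note [measurable] = W(1)[THEN lower_integrable_measurable]
    have "AE x in M. ecexp M F (\<lambda>x. W x + enn2ereal (?H x)) x = enn2ereal (?N (\<lambda>x. e2ennreal (W x + enn2ereal (?H x))) x)"
      by (intro ecexp_nonneg nonneg W) auto
    moreover have "AE x in M. ecexp M F (\<lambda>x. enn2ereal (?H x)) x = enn2ereal (?N (\<lambda>x. e2ennreal (enn2ereal (?H x))) x)"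
      by (intro ecexp_nonneg) auto
    ultimately show ?thesis using ecexp_add[OF W(1) li_H] by eventually_elim simp
  qed
  let ?f = "\<lambda>n x. e2ennreal (X n x + enn2ereal (?H x))"
  have "AE x in M. (SUP n. ?N (?f n) x) = ?N (\<lambda>x. SUP n. ?f n x) x"
  proof (rule nn_cond_exp_SUP)
    show "AE x in M. ?f n x \<le> ?f (Suc n) x" for n
      using mono[of n] by eventually_elim (intro e2ennreal_mono add_right_mono)
  qed auto
  moreover have "AE x in M. ?N (\<lambda>x. SUP n. ?f n x) x = ?N (\<lambda>x. e2ennreal (Y x + enn2ereal (?H x))) x"
  proof (rule nn_cond_exp_cong)
    have "AE x in M. ?H x \<noteq> \<infinity>" using Hfin by (intro nn_integral_PInf_AE) auto
    moreover have "AE x in M. incseq (\<lambda>n. X n x)"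
      using mono by (simp add: incseq_Suc_iff AE_all_countable)
    ultimately show "AE x in M. (SUP n. ?f n x) = e2ennreal (Y x + enn2ereal (?H x))"
      using Y(2)
    proof eventually_elim
      case (elim x)
      have *: "(\<lambda>n. X n x) \<longlonglongrightarrow> Y x" unfolding elim(3) by (rule LIMSEQ_SUP[OF elim(2)])
      have h: "\<bar>enn2ereal (?H x)\<bar> \<noteq> \<infinity>" using elim(1) by simp
      have "(\<lambda>n. X n x + enn2ereal (?H x)) \<longlonglongrightarrow> Y x + enn2ereal (?H x)"
        using h by (intro tendsto_add_ereal_general * tendsto_const) auto
      then have "(\<lambda>n. ?f n x) \<longlonglongrightarrow> e2ennreal (Y x + enn2ereal (?H x))"
        by (rule tendsto_e2ennrealI)
      moreover have "incseq (\<lambda>n. ?f n x)"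
        using elim(2) by (auto simp: incseq_def intro!: e2ennreal_mono add_right_mono)
      ultimately show ?case by (metis LIMSEQ_SUP LIMSEQ_unique)
    qed
  qed auto
  moreover have "AE x in M. ecexp M F Y x + enn2ereal (?N ?H x) = enn2ereal (?N (\<lambda>x. e2ennreal (Y x + enn2ereal (?H x))) x)"
    using Y(2) by (intro shift li_Y, elim eventually_mono) (auto intro: SUP_upper2[of 0])
  moreover have "AE x in M. \<forall>n. ecexp M F (X n) x + enn2ereal (?N ?H x) = enn2ereal (?N (?f n) x)"
    using shift[OF X X0] by (simp add: AE_all_countable)
  moreover have "AE x in M. \<forall>n. ecexp M F (X n) x \<le> Z x"
    using le by (simp add: AE_all_countable)
  moreover have "AE x in M. ?N ?H x < \<infinity>" using Hfin by (intro nn_cond_exp_finite) auto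
  ultimately show ?thesis
  proof eventually_elim
    case (elim x)
    have fin: "\<bar>enn2ereal (?N ?H x)\<bar> \<noteq> \<infinity>" using elim(6) by auto
    have "?N (?f n) x \<le> e2ennreal (Z x + enn2ereal (?N ?H x))" for n
    proof -
      have "enn2ereal (?N (?f n) x) \<le> Z x + enn2ereal (?N ?H x)"
        unfolding elim(4)[rule_format, symmetric] by (intro add_right_mono elim(5)[rule_format])
      from e2ennreal_mono[OF this] show ?thesis by simp
    qed
    then have "?N (\<lambda>x. e2ennreal (Y x + enn2ereal (?H x))) x \<le> e2ennreal (Z x + enn2ereal (?N ?H x))"
      unfolding elim(2)[symmetric] elim(1)[symmetric] by (rule SUP_least)
    then have "ecexp M F Y x + enn2ereal (?N ?H x) \<le> enn2ereal (e2ennreal (Z x + enn2ereal (?N ?H x)))"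
      using elim(3) by (simp add: less_eq_ennreal.rep_eq)
    \<comment> \<open>The round trip through \<open>ennreal\<close> is the identity only on
      nonnegative values; the bound by \<open>Z\<close> at index 0 supplies the sign.\<close>
    also have "enn2ereal (e2ennreal (Z x + enn2ereal (?N ?H x))) = Z x + enn2ereal (?N ?H x)"
    proof (rule enn2ereal_e2ennreal)
      have "0 \<le> ecexp M F (X 0) x + enn2ereal (?N ?H x)" using elim(4) by simp
      also have "\<dots> \<le> Z x + enn2ereal (?N ?H x)" using elim(5) by (intro add_right_mono) auto
      finally show "0 \<le> Z x + enn2ereal (?N ?H x)" .
    qed
    finally show ?case using fin by (cases "enn2ereal (?N ?H x)"; cases "ecexp M F Y x"; cases "Z x") auto
  qed
qed

text \<open>The inner conditional expectation splits into a nonnegative term and a term whose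
  integral is that of the negative part of \<open>X\<close>, hence finite. Additivity then reduces
  the claim to the tower property for nonnegative functions.\<close>

lemma ecexp_tower:
  assumes X: "lower_integrable M X" and G: "subalgebra M G" "subalgebra G F"
  shows "AE \<omega> in M. ecexp M F (ecexp M G X) \<omega> = ecexp M F X \<omega>"
proof -
  interpret G: sigma_finite_subalgebra M G
    by (rule nested_subalg_is_sigma_finite[OF G])
  note [measurable] = X[THEN lower_integrable_measurable]
  let ?p = "nn_cond_exp M G (\<lambda>x. e2ennreal (X x))" and ?m = "nn_cond_exp M G (\<lambda>x. e2ennreal (- X x))"
  have "(\<integral>\<^sup>+ x. ?m x \<partial>M) = (\<integral>\<^sup>+ x. e2ennreal (- X x) \<partial>M)"
    using G.nn_cond_exp_intg[of "\<lambda>_. 1" "\<lambda>x. e2ennreal (- X x)"] by simp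
  then have m: "lower_integrable M (\<lambda>x. - enn2ereal (?m x))"
    using X by (simp add: lower_integrable_def)
  have p: "lower_integrable M (\<lambda>x. enn2ereal (?p x))"
    by (intro lower_integrable_nonneg) auto
  have "AE \<omega> in M. ecexp M F (ecexp M G X) \<omega> = ecexp M F (\<lambda>x. enn2ereal (?p x)) \<omega> + ecexp M F (\<lambda>x. - enn2ereal (?m x)) \<omega>"
    using ecexp_add[OF p m] unfolding ecexp_def[of M G X] minus_ereal_def .
  moreover have "AE \<omega> in M. ecexp M F (\<lambda>x. enn2ereal (?p x)) \<omega> = enn2ereal (nn_cond_exp M F (\<lambda>x. e2ennreal (enn2ereal (?p x))) \<omega>)"
    by (rule ecexp_nonneg) auto
  moreover have "AE \<omega> in M. ecexp M F (\<lambda>x. - enn2ereal (?m x)) \<omega> = - enn2ereal (nn_cond_exp M F (\<lambda>x. e2ennreal (enn2ereal (?m x))) \<omega>)"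
    by (rule ecexp_uminus_nonneg) auto
  moreover have "AE \<omega> in M. nn_cond_exp M F (\<lambda>x. e2ennreal (X x)) \<omega> = nn_cond_exp M F ?p \<omega>"
    "AE \<omega> in M. nn_cond_exp M F (\<lambda>x. e2ennreal (- X x)) \<omega> = nn_cond_exp M F ?m \<omega>"
    by (intro nn_cond_exp_nested_subalg G; measurable)+
  ultimately show ?thesis
    by eventually_elim (simp add: ecexp_def[of M F X] minus_ereal_def)
qed

end

section \<open>Locality of conditional expectations\<close>

text \<open>The trace conditions make \<open>F\<close> and \<open>G\<close> indistinguishable inside
  \<open>A\<close>. Hence \<open>nn_cond_exp M G g\<close>, cut off outside \<open>A\<close>, is
  \<open>F\<close>-measurable and has the integrals that characterise the conditional expectation of
  \<open>indicator A x * f x\<close> given \<open>F\<close>.\<close>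

lemma nn_cond_exp_local:
  assumes F: "sigma_finite_subalgebra M F" and G: "sigma_finite_subalgebra M G"
    and A: "A \<in> sets F" "A \<in> sets G"
    and trace: "\<And>B. B \<in> sets F \<Longrightarrow> A \<inter> B \<in> sets G" "\<And>B. B \<in> sets G \<Longrightarrow> A \<inter> B \<in> sets F"
    and meas [measurable]: "f \<in> borel_measurable M" "g \<in> borel_measurable M"
    and eq: "AE x in M. x \<in> A \<longrightarrow> f x = g x"
  shows "AE x in M. x \<in> A \<longrightarrow> nn_cond_exp M F f x = nn_cond_exp M G g x"
proof -
  interpret F: sigma_finite_subalgebra M F by fact
  interpret G: sigma_finite_subalgebra M G by fact
  have AM [measurable]: "A \<in> sets M" using A F.subalg by (auto simp: subalgebra_def)
  have sp: "space F = space M" "space G = space M"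
    using F.subalg G.subalg by (auto simp: subalgebra_def)
  \<comment> \<open>Inside \<open>A\<close> a preimage under \<open>nn_cond_exp M G g\<close> is a
    trace of a set of \<open>G\<close>, hence in \<open>F\<close>; outside \<open>A\<close> the
    function is the constant 0.\<close>
  have gm: "(\<lambda>x. indicator A x * nn_cond_exp M G g x) \<in> borel_measurable F"
  proof -
    have "(\<lambda>x. if x \<in> A then nn_cond_exp M G g x else 0) \<in> borel_measurable F"
    proof (rule borel_measurableI)
      fix S :: "ennreal set" assume "open S"
      have 1: "A \<inter> (nn_cond_exp M G g -` S \<inter> space G) \<in> sets F"
        by (rule trace(2), rule measurable_sets[OF borel_measurable_nn_cond_exp]) (use \<open>open S\<close> in auto)
      have 2: "space F - A \<in> sets F" using A by auto
      have "(\<lambda>x. if x \<in> A then nn_cond_exp M G g x else 0) -` S \<inter> space F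
        = (A \<inter> (nn_cond_exp M G g -` S \<inter> space G)) \<union> (if 0 \<in> S then space F - A else {})"
        using sp sets.sets_into_space[OF A(1)] by (auto split: if_splits)
      then show "(\<lambda>x. if x \<in> A then nn_cond_exp M G g x else 0) -` S \<inter> space F \<in> sets F"
        using 1 2 by auto
    qed
    moreover have "(\<lambda>x. indicator A x * nn_cond_exp M G g x) = (\<lambda>x. if x \<in> A then nn_cond_exp M G g x else 0)"
      by (auto simp: indicator_def)
    ultimately show ?thesis by simp
  qed
  have iA: "(indicator A :: 'a \<Rightarrow> ennreal) \<in> borel_measurable F" using A by auto
  have "AE x in M. indicator A x * nn_cond_exp M G g x = nn_cond_exp M F (\<lambda>x. indicator A x * f x) x"
  proof (rule F.nn_cond_exp_charact)
    fix B assume B: "B \<in> sets F"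
    have BM [measurable]: "B \<in> sets M" using B F.subalg by (auto simp: subalgebra_def)
    have AB: "(indicator (A \<inter> B) :: 'a \<Rightarrow> ennreal) \<in> borel_measurable G"
      using trace(1)[OF B] by auto
    have "(\<integral>\<^sup>+ x\<in>B. (indicator A x * f x) \<partial>M) = (\<integral>\<^sup>+ x. indicator (A \<inter> B) x * g x \<partial>M)"
      using eq by (intro nn_integral_cong_AE) (auto simp: indicator_def)
    also have "\<dots> = (\<integral>\<^sup>+ x. indicator (A \<inter> B) x * nn_cond_exp M G g x \<partial>M)"
      using G.nn_cond_exp_intg[OF AB] by simp
    also have "\<dots> = (\<integral>\<^sup>+ x\<in>B. (indicator A x * nn_cond_exp M G g x) \<partial>M)"
      by (intro nn_integral_cong) (auto simp: indicator_def)
    finally show "(\<integral>\<^sup>+ x\<in>B. (indicator A x * f x) \<partial>M) = (\<integral>\<^sup>+ x\<in>B. (indicator A x * nn_cond_exp M G g x) \<partial>M)" .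
  qed (use gm in auto)
  moreover have "AE x in M. indicator A x * nn_cond_exp M F f x = nn_cond_exp M F (\<lambda>x. indicator A x * f x) x"
    by (rule F.nn_cond_exp_prod[OF iA]) simp
  ultimately show ?thesis by eventually_elim auto
qed

lemma ecexp_local:
  assumes "sigma_finite_subalgebra M F" "sigma_finite_subalgebra M G"
    "A \<in> sets F" "A \<in> sets G"
    "\<And>B. B \<in> sets F \<Longrightarrow> A \<inter> B \<in> sets G" "\<And>B. B \<in> sets G \<Longrightarrow> A \<inter> B \<in> sets F"
    and [measurable]: "X \<in> borel_measurable M" "Y \<in> borel_measurable M"
    and eq: "AE x in M. x \<in> A \<longrightarrow> X x = Y x"
  shows "AE x in M. x \<in> A \<longrightarrow> ecexp M F X x = ecexp M G Y x"
proof -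
  have "AE x in M. x \<in> A \<longrightarrow> nn_cond_exp M F (\<lambda>x. e2ennreal (X x)) x = nn_cond_exp M G (\<lambda>x. e2ennreal (Y x)) x"
    using eq by (intro nn_cond_exp_local assms) auto
  moreover have "AE x in M. x \<in> A \<longrightarrow> nn_cond_exp M F (\<lambda>x. e2ennreal (- X x)) x = nn_cond_exp M G (\<lambda>x. e2ennreal (- Y x)) x"
    using eq by (intro nn_cond_exp_local assms) auto
  ultimately show ?thesis by eventually_elim (auto simp: ecexp_def)
qed

lemma lower_integrable_if:
  assumes X: "lower_integrable M X" and Y: "lower_integrable M Y"
    and P [measurable]: "Measurable.pred M P"
  shows "lower_integrable M (\<lambda>\<omega>. if P \<omega> then X \<omega> else Y \<omega>)"
proof -
  note [measurable] = X[THEN lower_integrable_measurable] Y[THEN lower_integrable_measurable]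
  have "(\<integral>\<^sup>+ \<omega>. e2ennreal (- (if P \<omega> then X \<omega> else Y \<omega>)) \<partial>M)
      \<le> (\<integral>\<^sup>+ \<omega>. e2ennreal (- X \<omega>) + e2ennreal (- Y \<omega>) \<partial>M)"
    by (intro nn_integral_mono) auto
  also have "\<dots> = (\<integral>\<^sup>+ \<omega>. e2ennreal (- X \<omega>) \<partial>M) + (\<integral>\<^sup>+ \<omega>. e2ennreal (- Y \<omega>) \<partial>M)"
    by (intro nn_integral_add) auto
  also have "\<dots> < \<infinity>"
    using X Y by (auto simp: lower_integrable_def)
  finally show ?thesis by (simp add: lower_integrable_def)
qed

lemma (in sigma_finite_subalgebra) ecexp_abs_finite:
  assumes [measurable]: "X \<in> borel_measurable M" and "AE \<omega> in M. 0 \<le> X \<omega>"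
    and "(\<integral>\<^sup>+ \<omega>. e2ennreal (X \<omega>) \<partial>M) < \<infinity>"
  shows "AE \<omega> in M. \<bar>ecexp M F X \<omega>\<bar> \<noteq> \<infinity>"
proof -
  have "AE \<omega> in M. nn_cond_exp M F (\<lambda>x. e2ennreal (X x)) \<omega> < \<infinity>"
    using assms(3) by (intro nn_cond_exp_finite) auto
  then show ?thesis
    using ecexp_nonneg[OF assms(1,2)] by eventually_elim auto
qed

lemma AE_less_infty_of_nn_integral:
  assumes "X \<in> borel_measurable M" "(\<integral>\<^sup>+ \<omega>. e2ennreal (X \<omega>) \<partial>M) < \<infinity>"
  shows "AE \<omega> in M. X \<omega> < \<infinity>"
proof -
  have "AE \<omega> in M. e2ennreal (X \<omega>) \<noteq> \<infinity>"
    using assms by (intro nn_integral_PInf_AE) auto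
  then show ?thesis by eventually_elim (auto simp: less_top)
qed

text \<open>Passes from an integrable envelope of all negative parts to each single stopping
  time.\<close>

lemma (in finite_measure) lower_integrable_of_esssup:
  assumes I: "\<And>i. i \<in> I \<Longrightarrow> X i \<in> borel_measurable M"
    and fin: "(\<integral>\<^sup>+ \<omega>. e2ennreal (esssupF M I (\<lambda>i \<omega>. max 0 (- X i \<omega>)) \<omega>) \<partial>M) < \<infinity>" and i: "i \<in> I"
  shows "lower_integrable M (X i)"
proof -
  have "is_esssup M I (\<lambda>i \<omega>. max 0 (- X i \<omega>)) (esssupF M I (\<lambda>i \<omega>. max 0 (- X i \<omega>)))"
    using I by (intro is_esssup_esssupF) auto
  then have "AE \<omega> in M. max 0 (- X i \<omega>) \<le> esssupF M I (\<lambda>i \<omega>. max 0 (- X i \<omega>)) \<omega>"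
    using i by (simp add: is_esssup_def)
  then have "(\<integral>\<^sup>+ \<omega>. e2ennreal (- X i \<omega>) \<partial>M)
      \<le> (\<integral>\<^sup>+ \<omega>. e2ennreal (esssupF M I (\<lambda>i \<omega>. max 0 (- X i \<omega>)) \<omega>) \<partial>M)"
    by (intro nn_integral_mono_AE, elim eventually_mono) (simp add: e2ennreal_mono)
  then show ?thesis using fin I[OF i] by (simp add: lower_integrable_def)
qed

text \<open>\<open>B\<close> differs from \<open>A\<close> only inside a null set, all of whose
  subsets lie in \<open>G\<close>. This is how completeness of the filtration absorbs relations that
  hold only almost everywhere.\<close>

lemma sets_AE_cong:
  assumes null: "\<And>N B. N \<in> null_sets M \<Longrightarrow> B \<subseteq> N \<Longrightarrow> B \<in> sets G"
    and A: "A \<in> sets G" "A \<subseteq> space M" and B: "B \<subseteq> space M"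
    and AE: "AE \<omega> in M. \<omega> \<in> A \<longleftrightarrow> \<omega> \<in> B"
  shows "B \<in> sets G"
proof -
  obtain N where N: "{\<omega> \<in> space M. \<not> (\<omega> \<in> A \<longleftrightarrow> \<omega> \<in> B)} \<subseteq> N" "N \<in> null_sets M"
    using AE by (auto simp: eventually_ae_filter)
  have "B = (A - N) \<union> (B \<inter> N)" using N(1) A B by auto
  also have "\<dots> \<in> sets G" using A null[OF N(2)] by auto
  finally show ?thesis .
qed

lemma measurable_AE_cong:
  fixes f g :: "'a \<Rightarrow> 'b :: topological_space"
  assumes null: "\<And>N B. N \<in> null_sets M \<Longrightarrow> B \<subseteq> N \<Longrightarrow> B \<in> sets G"
    and sp: "space G = space M" and f: "f \<in> borel_measurable G"
    and AE: "AE \<omega> in M. f \<omega> = g \<omega>"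
  shows "g \<in> borel_measurable G"
proof (rule borel_measurableI)
  fix S :: "'b set" assume "open S"
  show "g -` S \<inter> space G \<in> sets G"
  proof (rule sets_AE_cong[OF null, of M])
    show "f -` S \<inter> space G \<in> sets G" using f \<open>open S\<close> by (auto intro: measurable_sets)
    show "AE \<omega> in M. \<omega> \<in> f -` S \<inter> space G \<longleftrightarrow> \<omega> \<in> g -` S \<inter> space G"
      using AE by eventually_elim auto
  qed (auto simp: sp)
qed

subsection \<open>Stopping times and Snell envelopes\<close>

locale usual_filtered_space = prob_space M
  for M :: "'a measure" +
  fixes F :: "real \<Rightarrow> 'a measure" and T :: real
  assumes T_pos: "0 < T" and usual: "usual_filtration M F T" and sets_F_T: "sets (F T) = sets M"
begin

abbreviation STs :: "'a stime set" where "STs \<equiv> ST M F T"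
abbreviation STs_from :: "'a stime \<Rightarrow> 'a stime set" where "STs_from \<equiv> ST_from M F T"
abbreviation G :: "'a stime \<Rightarrow> 'a measure" where "G \<equiv> F_st M F T"

lemma space_F: "t \<in> {0..T} \<Longrightarrow> space (F t) = space M"
  using usual unfolding usual_filtration_def by (elim conjE) simp

lemma sets_F_mono: "0 \<le> s \<Longrightarrow> s \<le> t \<Longrightarrow> t \<le> T \<Longrightarrow> A \<in> sets (F s) \<Longrightarrow> A \<in> sets (F t)"
  using usual unfolding usual_filtration_def by (elim conjE) (rule subsetD, simp_all)

lemma subset_null_set: "N \<in> null_sets M \<Longrightarrow> B \<subseteq> N \<Longrightarrow> B \<in> null_sets M"
  using usual unfolding usual_filtration_def by (meson null_sets_subset)

lemma null_sets_F:
  assumes "N \<in> null_sets M" "B \<subseteq> N" "t \<in> {0..T}"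
  shows "B \<in> sets (F t)"
proof -
  have "B \<in> sets (F 0)"
    using usual subset_null_set[OF assms(1,2)] unfolding usual_filtration_def by auto
  then show ?thesis using assms(3) by (intro sets_F_mono[of 0 t]) auto
qed

lemma ST_bounds: "\<theta> \<in> STs \<Longrightarrow> \<omega> \<in> space M \<Longrightarrow> 0 \<le> \<theta> \<omega> \<and> \<theta> \<omega> \<le> T"
  by (auto simp: ST_def stopping_time_T_def)

lemma ST_le_sets: "\<theta> \<in> STs \<Longrightarrow> t \<in> {0..T} \<Longrightarrow> {\<omega>\<in>space M. \<theta> \<omega> \<le> t} \<in> sets (F t)"
  by (auto simp: ST_def stopping_time_T_def)

lemma ST_I:
  assumes "\<And>\<omega>. \<omega> \<in> space M \<Longrightarrow> 0 \<le> \<theta> \<omega> \<and> \<theta> \<omega> \<le> T"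
    "\<And>t. t \<in> {0..T} \<Longrightarrow> {\<omega>\<in>space M. \<theta> \<omega> \<le> t} \<in> sets (F t)"
  shows "\<theta> \<in> STs"
  using assms by (auto simp: ST_def stopping_time_T_def)

lemma const_ST: "c \<in> {0..T} \<Longrightarrow> (\<lambda>_. c) \<in> STs"
proof (rule ST_I)
  fix t assume "t \<in> {0..T}"
  have "{\<omega> \<in> space M. c \<le> t} = (if c \<le> t then space (F t) else {})"
    using space_F[OF \<open>t \<in> {0..T}\<close>] by auto
  then show "{\<omega> \<in> space M. c \<le> t} \<in> sets (F t)" by simp
qed auto

lemma min_ST:
  assumes "\<theta> \<in> STs" "\<tau> \<in> STs" shows "(\<lambda>\<omega>. min (\<theta> \<omega>) (\<tau> \<omega>)) \<in> STs"
proof (rule ST_I)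
  show "0 \<le> min (\<theta> \<omega>) (\<tau> \<omega>) \<and> min (\<theta> \<omega>) (\<tau> \<omega>) \<le> T" if "\<omega> \<in> space M" for \<omega>
    using ST_bounds[OF assms(1) that] ST_bounds[OF assms(2) that] by auto
  fix t assume t: "t \<in> {0..T}"
  have "{\<omega>\<in>space M. min (\<theta> \<omega>) (\<tau> \<omega>) \<le> t} = {\<omega>\<in>space M. \<theta> \<omega> \<le> t} \<union> {\<omega>\<in>space M. \<tau> \<omega> \<le> t}"
    by auto
  then show "{\<omega>\<in>space M. min (\<theta> \<omega>) (\<tau> \<omega>) \<le> t} \<in> sets (F t)"
    using ST_le_sets[OF assms(1) t] ST_le_sets[OF assms(2) t] by auto
qed

section \<open>The sigma-algebra at a stopping time\<close>

text \<open>The generating collection is already closed under complements and countable unions, so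
  membership can be tested without the generated sigma-algebra.\<close>

lemma sets_G:
  assumes "\<theta> \<in> STs"
  shows "sets (G \<theta>) = {A \<in> sets M. \<forall>t\<in>{0..T}. A \<inter> {\<omega>\<in>space M. \<theta> \<omega> \<le> t} \<in> sets (F t)}" (is "_ = ?S")
proof -
  have "sigma_algebra (space M) ?S"
    unfolding sigma_algebra_iff2
  proof (intro conjI ballI allI impI)
    show "?S \<subseteq> Pow (space M)" using sets.sets_into_space by auto
    show "{} \<in> ?S" by auto
    show "space M - A \<in> ?S" if "A \<in> ?S" for A
    proof (safe; (intro sets.compl_sets)?)
      show "A \<in> sets M" using that by auto
      fix t assume t: "t \<in> {0..T}"
      \<comment> \<open>The complement is taken relative to \<open>{\<theta> \<le> t}\<close>,
        because \<open>A\<close> itself need not lie in \<open>F t\<close>.\<close>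
      have "(space M - A) \<inter> {\<omega> \<in> space M. \<theta> \<omega> \<le> t} = {\<omega> \<in> space M. \<theta> \<omega> \<le> t} - A \<inter> {\<omega> \<in> space M. \<theta> \<omega> \<le> t}"
        by auto
      then show "(space M - A) \<inter> {\<omega> \<in> space M. \<theta> \<omega> \<le> t} \<in> sets (F t)"
        using that t ST_le_sets[OF assms t] by auto
    qed
    show "(\<Union>i. A i) \<in> ?S" if "range A \<subseteq> ?S" for A :: "nat \<Rightarrow> _"
    proof safe
      show "(\<Union>i. A i) \<in> sets M" using that by (intro sets.countable_UN) auto
      fix t assume t: "t \<in> {0..T}"
      have "(\<Union>i. A i) \<inter> {\<omega> \<in> space M. \<theta> \<omega> \<le> t} = (\<Union>i. A i \<inter> {\<omega> \<in> space M. \<theta> \<omega> \<le> t})"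
        by auto
      also have "\<dots> \<in> sets (F t)" using that t by (intro sets.countable_UN) auto
      finally show "(\<Union>i. A i) \<inter> {\<omega> \<in> space M. \<theta> \<omega> \<le> t} \<in> sets (F t)" .
    qed
  qed
  then show ?thesis
    unfolding F_st_def by (rule sigma_algebra.sets_measure_of_eq)
qed

lemma space_G: "space (G \<theta>) = space M"
  unfolding F_st_def by (rule space_measure_of) (auto dest: sets.sets_into_space)

lemma null_sets_G:
  assumes "\<theta> \<in> STs" "N \<in> null_sets M" "B \<subseteq> N"
  shows "B \<in> sets (G \<theta>)"
  unfolding sets_G[OF assms(1)]
  using subset_null_set[OF assms(2,3)] assms(3) by (auto intro: null_sets_F[OF assms(2)])

lemma subalgebra_G: "\<theta> \<in> STs \<Longrightarrow> subalgebra M (G \<theta>)"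
  unfolding subalgebra_def by (auto simp: space_G sets_G)

lemma sigma_finite_G: "\<theta> \<in> STs \<Longrightarrow> sigma_finite_subalgebra M (G \<theta>)"
  by (intro finite_measure_subalgebra_is_sigma_finite finite_measure_subalgebra.intro
      finite_measure_subalgebra_axioms.intro subalgebra_G finite_measure_axioms)

lemma measurable_G_M: "\<theta> \<in> STs \<Longrightarrow> f \<in> borel_measurable (G \<theta>) \<Longrightarrow> f \<in> borel_measurable M"
  by (rule measurable_from_subalg[OF subalgebra_G])

text \<open>Intersecting with \<open>{\<theta> \<le> t}\<close> as well changes
  \<open>A \<inter> {\<tau> \<le> t}\<close> only on the null set where \<open>\<theta>\<close>
  exceeds \<open>\<tau>\<close>, and \<open>F t\<close> contains all subsets of null sets.\<close>

lemma sets_G_mono: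
  assumes "\<theta> \<in> STs" "\<tau> \<in> STs" "AE \<omega> in M. \<theta> \<omega> \<le> \<tau> \<omega>" "A \<in> sets (G \<theta>)"
  shows "A \<in> sets (G \<tau>)"
  unfolding sets_G[OF assms(2)]
proof safe
  show AM: "A \<in> sets M" using assms(1,4) by (simp add: sets_G)
  fix t assume t: "t \<in> {0..T}"
  show "A \<inter> {\<omega>\<in>space M. \<tau> \<omega> \<le> t} \<in> sets (F t)"
  proof (rule sets_AE_cong[where M = M])
    show "B \<in> sets (F t)" if "N \<in> null_sets M" "B \<subseteq> N" for N B
      using null_sets_F[OF that t] .
    show "(A \<inter> {\<omega>\<in>space M. \<theta> \<omega> \<le> t}) \<inter> {\<omega>\<in>space M. \<tau> \<omega> \<le> t} \<in> sets (F t)"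
      using assms(1,4) t by (intro sets.Int[OF _ ST_le_sets[OF assms(2) t]]) (simp add: sets_G)
    show "AE \<omega> in M. \<omega> \<in> (A \<inter> {\<omega>\<in>space M. \<theta> \<omega> \<le> t}) \<inter> {\<omega>\<in>space M. \<tau> \<omega> \<le> t}
        \<longleftrightarrow> \<omega> \<in> A \<inter> {\<omega>\<in>space M. \<tau> \<omega> \<le> t}"
      using assms(3) by eventually_elim auto
  qed auto
qed

lemma subalgebra_G_G:
  "\<theta> \<in> STs \<Longrightarrow> \<tau> \<in> STs \<Longrightarrow> AE \<omega> in M. \<theta> \<omega> \<le> \<tau> \<omega> \<Longrightarrow> subalgebra (G \<tau>) (G \<theta>)"
  unfolding subalgebra_def by (auto simp: space_G intro: sets_G_mono)

lemma ST_min_measurable: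
  assumes "\<theta> \<in> STs" "t \<in> {0..T}"
  shows "(\<lambda>\<omega>. min (\<theta> \<omega>) t) \<in> borel_measurable (F t)"
  unfolding borel_measurable_iff_le
proof
  fix a
  consider "a < 0" | "0 \<le> a" "a < t" | "t \<le> a" by linarith
  then show "{\<omega> \<in> space (F t). min (\<theta> \<omega>) t \<le> a} \<in> sets (F t)"
  proof cases
    case 1
    then have "{\<omega> \<in> space (F t). min (\<theta> \<omega>) t \<le> a} = {}"
      using ST_bounds[OF assms(1)] assms(2) by (fastforce simp: space_F[OF assms(2)] min_le_iff_disj)
    then show ?thesis by (simp only: sets.empty_sets)
  next
    case 2
    then have "{\<omega> \<in> space (F t). min (\<theta> \<omega>) t \<le> a} = {\<omega> \<in> space M. \<theta> \<omega> \<le> a}"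
      using assms(2) by (auto simp: space_F)
    then show ?thesis using 2 assms ST_le_sets[OF assms(1), of a]
      by (auto intro: sets_F_mono[of a t])
  next
    case 3
    then have "{\<omega> \<in> space (F t). min (\<theta> \<omega>) t \<le> a} = space (F t)" by auto
    then show ?thesis by simp
  qed
qed

lemma ST_measurable: "\<theta> \<in> STs \<Longrightarrow> \<theta> \<in> borel_measurable M"
proof -
  assume \<theta>: "\<theta> \<in> STs"
  have "(\<lambda>\<omega>. min (\<theta> \<omega>) T) \<in> borel_measurable (F T)"
    by (rule ST_min_measurable[OF \<theta>]) (use T_pos in auto)
  then have "(\<lambda>\<omega>. min (\<theta> \<omega>) T) \<in> borel_measurable M"
    by (simp add: measurable_cong_sets[OF sets_F_T refl])
  moreover have "min (\<theta> \<omega>) T = \<theta> \<omega>" if "\<omega> \<in> space M" for \<omega>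
    using ST_bounds[OF \<theta> that] by simp
  ultimately show ?thesis by (simp cong: measurable_cong)
qed

text \<open>Up to time \<open>t\<close> equality of the two times can be read off from their
  truncations at \<open>t\<close>, which are \<open>F t\<close>-measurable. This supplies the trace
  conditions of \<open>ecexp_local\<close> on the event
  \<open>{\<theta> = \<theta>'}\<close>.\<close>

lemma eq_Int_sets_G:
  assumes "\<theta> \<in> STs" "\<theta>' \<in> STs" "B \<in> sets (G \<theta>)"
  shows "{\<omega>\<in>space M. \<theta> \<omega> = \<theta>' \<omega>} \<inter> B \<in> sets (G \<theta>')"
  unfolding sets_G[OF assms(2)]
proof safe
  note [measurable] = ST_measurable[OF assms(1)] ST_measurable[OF assms(2)]
  have BM: "B \<in> sets M" using assms by (simp add: sets_G)
  have "{\<omega>\<in>space M. \<theta> \<omega> = \<theta>' \<omega>} \<in> sets M" by measurable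
  then show "{\<omega>\<in>space M. \<theta> \<omega> = \<theta>' \<omega>} \<inter> B \<in> sets M" using BM by auto
  fix t assume t: "t \<in> {0..T}"
  note [measurable] = ST_min_measurable[OF assms(1) t] ST_min_measurable[OF assms(2) t]
  have "{\<omega>\<in>space (F t). min (\<theta> \<omega>) t = min (\<theta>' \<omega>) t} \<in> sets (F t)" by measurable
  moreover have "B \<inter> {\<omega>\<in>space M. \<theta> \<omega> \<le> t} \<in> sets (F t)" using assms t by (simp add: sets_G)
  moreover have "{\<omega>\<in>space M. \<theta> \<omega> = \<theta>' \<omega>} \<inter> B \<inter> {\<omega>\<in>space M. \<theta>' \<omega> \<le> t}
    = {\<omega>\<in>space (F t). min (\<theta> \<omega>) t = min (\<theta>' \<omega>) t} \<inter> (B \<inter> {\<omega>\<in>space M. \<theta> \<omega> \<le> t}) \<inter> {\<omega>\<in>space M. \<theta>' \<omega> \<le> t}"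
    using space_F[OF t] by (auto simp: min_def split: if_splits)
  ultimately show "{\<omega>\<in>space M. \<theta> \<omega> = \<theta>' \<omega>} \<inter> B \<inter> {\<omega>\<in>space M. \<theta>' \<omega> \<le> t} \<in> sets (F t)"
    using ST_le_sets[OF assms(2) t] by (simp only: sets.Int)
qed

text \<open>Pasting needs each choice \<open>N = n\<close> to be known by time
  \<open>\<tau> n\<close>. It serves to switch stopping times on an event and to select among
  countably many competitors.\<close>

lemma glue_ST:
  fixes \<tau> :: "nat \<Rightarrow> 'a stime" and N :: "'a \<Rightarrow> nat"
  assumes \<tau>: "\<And>n. \<tau> n \<in> STs" and N: "\<And>n. {\<omega>\<in>space M. N \<omega> = n} \<in> sets (G (\<tau> n))"
  shows "(\<lambda>\<omega>. \<tau> (N \<omega>) \<omega>) \<in> STs"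
proof (rule ST_I)
  fix t assume t: "t \<in> {0..T}"
  have "{\<omega>\<in>space M. \<tau> (N \<omega>) \<omega> \<le> t} = (\<Union>n. {\<omega>\<in>space M. N \<omega> = n} \<inter> {\<omega>\<in>space M. \<tau> n \<omega> \<le> t})"
    by auto
  also have "\<dots> \<in> sets (F t)"
    using N t by (intro sets.countable_UN) (auto simp: sets_G[OF \<tau>])
  finally show "{\<omega>\<in>space M. \<tau> (N \<omega>) \<omega> \<le> t} \<in> sets (F t)" .
qed (use ST_bounds[OF \<tau>] in auto)

lemma ST_from_ST: "\<tau> \<in> STs_from \<theta> \<Longrightarrow> \<tau> \<in> STs"
  and ST_from_le: "\<tau> \<in> STs_from \<theta> \<Longrightarrow> AE \<omega> in M. \<theta> \<omega> \<le> \<tau> \<omega>"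
  and ST_from_I: "\<tau> \<in> STs \<Longrightarrow> AE \<omega> in M. \<theta> \<omega> \<le> \<tau> \<omega> \<Longrightarrow> \<tau> \<in> STs_from \<theta>"
  by (auto simp: ST_from_def)

lemma ST_from_refl: "\<theta> \<in> STs \<Longrightarrow> \<theta> \<in> STs_from \<theta>"
  by (rule ST_from_I) auto

lemma ST_from_T: "\<theta> \<in> STs \<Longrightarrow> (\<lambda>_. T) \<in> STs_from \<theta>"
  using T_pos ST_bounds[of \<theta>] by (intro ST_from_I const_ST AE_I2) auto

lemma ST_from_trans:
  assumes "\<tau> \<in> STs_from \<theta>" "\<rho> \<in> STs_from \<tau>" shows "\<rho> \<in> STs_from \<theta>"
  using ST_from_le[OF assms(1)] ST_from_le[OF assms(2)]
  by (intro ST_from_I ST_from_ST[OF assms(2)], eventually_elim) auto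

lemma admissible_measurable: "admissible M F T \<psi> \<Longrightarrow> \<theta> \<in> STs \<Longrightarrow> \<psi> \<theta> \<in> borel_measurable (G \<theta>)"
  and admissible_cong: "admissible M F T \<psi> \<Longrightarrow> \<theta> \<in> STs \<Longrightarrow> \<theta>' \<in> STs
     \<Longrightarrow> AE \<omega> in M. \<theta> \<omega> = \<theta>' \<omega> \<longrightarrow> \<psi> \<theta> \<omega> = \<psi> \<theta>' \<omega>"
  by (auto simp: admissible_def)

lemma admissible_measurable_M: "admissible M F T \<psi> \<Longrightarrow> \<theta> \<in> STs \<Longrightarrow> \<psi> \<theta> \<in> borel_measurable M"
  by (rule measurable_G_M[OF _ admissible_measurable])

lemma measurable_ecexp_G: "\<theta> \<in> STs \<Longrightarrow> ecexp M (G \<theta>) X \<in> borel_measurable (G \<theta>)"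
  and measurable_ecexp_M: "\<theta> \<in> STs \<Longrightarrow> ecexp M (G \<theta>) X \<in> borel_measurable M"
  using sigma_finite_subalgebra.measurable_ecexp[OF sigma_finite_G]
    sigma_finite_subalgebra.measurable_ecexp'[OF sigma_finite_G] by auto

section \<open>Snell envelopes: consistency, near-optimal times, supermartingale property\<close>

text \<open>A relation instead of a function, since envelopes are unique only almost everywhere:
  both the choice term \<open>esssupF\<close> and a pointwise limit of envelopes can then
  qualify.\<close>

definition snell :: "'a family \<Rightarrow> 'a family \<Rightarrow> bool" where
  "snell \<psi> v \<longleftrightarrow> (\<forall>\<theta>\<in>STs. is_esssup M (STs_from \<theta>) (\<lambda>\<tau>. ecexp M (G \<theta>) (\<psi> \<tau>)) (v \<theta>))"

lemma snell_is_esssup: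
  "snell \<psi> v \<Longrightarrow> \<theta> \<in> STs \<Longrightarrow> is_esssup M (STs_from \<theta>) (\<lambda>\<tau>. ecexp M (G \<theta>) (\<psi> \<tau>)) (v \<theta>)"
  by (simp add: snell_def)

lemma snell_ge:
  "snell \<psi> v \<Longrightarrow> \<theta> \<in> STs \<Longrightarrow> \<tau> \<in> STs_from \<theta> \<Longrightarrow> AE \<omega> in M. ecexp M (G \<theta>) (\<psi> \<tau>) \<omega> \<le> v \<theta> \<omega>"
  by (auto simp: snell_def is_esssup_def)

lemma snell_le:
  assumes "snell \<psi> v" "\<theta> \<in> STs" "Z \<in> borel_measurable M"
    "\<And>\<tau>. \<tau> \<in> STs_from \<theta> \<Longrightarrow> AE \<omega> in M. ecexp M (G \<theta>) (\<psi> \<tau>) \<omega> \<le> Z \<omega>"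
  shows "AE \<omega> in M. v \<theta> \<omega> \<le> Z \<omega>"
  using snell_is_esssup[OF assms(1,2)] assms(3,4) by (simp add: is_esssup_def)

lemma snell_esssupF:
  "snell \<psi> (\<lambda>\<theta>. esssupF M (STs_from \<theta>) (\<lambda>\<tau>. ecexp M (G \<theta>) (\<psi> \<tau>)))"
  unfolding snell_def by (intro ballI is_esssup_esssupF measurable_ecexp_M)

text \<open>A countable supremum of \<open>G \<theta>\<close>-measurable versions gives the
  measurability. For consistency, every competitor of \<open>\<theta>\<close> is matched on
  \<open>{\<theta> = \<theta>'}\<close> by a competitor of \<open>\<theta>'\<close> with the same
  conditional payoff there.\<close>

lemma admissible_snell:
  assumes \<psi>: "admissible M F T \<psi>" and v: "snell \<psi> v"
  shows "admissible M F T v"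
  unfolding admissible_def
proof (intro conjI ballI)
  fix \<theta> assume \<theta>: "\<theta> \<in> STs"
  obtain C where C: "C \<subseteq> STs_from \<theta>" "countable C"
      "AE \<omega> in M. v \<theta> \<omega> = (SUP \<tau>\<in>C. ecexp M (G \<theta>) (\<psi> \<tau>) \<omega>)"
    using is_esssup_countable[OF snell_is_esssup[OF v \<theta>]] measurable_ecexp_M[OF \<theta>] by metis
  show "v \<theta> \<in> borel_measurable (G \<theta>)"
  proof (rule measurable_AE_cong[where M = M])
    show "(\<lambda>\<omega>. SUP \<tau>\<in>C. ecexp M (G \<theta>) (\<psi> \<tau>) \<omega>) \<in> borel_measurable (G \<theta>)"
      using C(2) by (intro borel_measurable_SUP measurable_ecexp_G \<theta>) auto
    show "AE \<omega> in M. (SUP \<tau>\<in>C. ecexp M (G \<theta>) (\<psi> \<tau>) \<omega>) = v \<theta> \<omega>"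
      using C(3) by eventually_elim simp
  qed (use null_sets_G[OF \<theta>] space_G in auto)
next
  have le: "AE \<omega> in M. \<theta> \<omega> = \<theta>' \<omega> \<longrightarrow> v \<theta> \<omega> \<le> v \<theta>' \<omega>"
    if \<theta>: "\<theta> \<in> STs" and \<theta>': "\<theta>' \<in> STs" for \<theta> \<theta>'
  proof -
    note [measurable] = ST_measurable[OF \<theta>] ST_measurable[OF \<theta>']
    have [measurable]: "v \<theta>' \<in> borel_measurable M"
      using snell_is_esssup[OF v \<theta>'] by (simp add: is_esssup_def)
    let ?A = "{\<omega>\<in>space M. \<theta> \<omega> = \<theta>' \<omega>}"
    have A': "?A \<in> sets (G \<theta>')"
      using eq_Int_sets_G[OF \<theta> \<theta>' sets.top] by (simp add: space_G Int_absorb2)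
    have A: "?A \<in> sets (G \<theta>)"
      using eq_Int_sets_G[OF \<theta>' \<theta> sets.top] by (simp add: space_G Int_absorb2 eq_commute)
    \<comment> \<open>The value \<infinity> off the event turns a local comparison into a global
      upper bound, to which minimality of the essential supremum applies.\<close>
    have "AE \<omega> in M. v \<theta> \<omega> \<le> (if \<theta> \<omega> = \<theta>' \<omega> then v \<theta>' \<omega> else \<infinity>)"
    proof (rule snell_le[OF v \<theta>])
      show "(\<lambda>\<omega>. if \<theta> \<omega> = \<theta>' \<omega> then v \<theta>' \<omega> else \<infinity>) \<in> borel_measurable M" by measurable
      fix \<tau> assume \<tau>: "\<tau> \<in> STs_from \<theta>"
      \<comment> \<open>The competitor follows \<open>\<tau>\<close> on the event and waits until
        \<open>T\<close> elsewhere; \<open>T\<close> lies after every stopping time, so the result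
        lies after \<open>\<theta>'\<close>.\<close>
      define N :: "'a \<Rightarrow> nat" where "N \<omega> = (if \<theta> \<omega> = \<theta>' \<omega> then 0 else 1)" for \<omega>
      define s :: "nat \<Rightarrow> 'a stime" where "s n = (if n = 0 then \<tau> else (\<lambda>_. T))" for n
      define \<tau>' where "\<tau>' = (\<lambda>\<omega>. s (N \<omega>) \<omega>)"
      have sT: "s n \<in> STs_from \<theta>" for n using ST_from_T[OF \<theta>] \<tau> by (simp add: s_def)
      have "\<tau>' \<in> STs" unfolding \<tau>'_def
      proof (rule glue_ST)
        show "s n \<in> STs" for n using sT by (rule ST_from_ST)
        fix n
        have "{\<omega>\<in>space M. N \<omega> = n} = (if n = 0 then ?A else if n = 1 then space (G \<theta>) - ?A else {})"
          by (auto simp: N_def space_G)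
        then have "{\<omega>\<in>space M. N \<omega> = n} \<in> sets (G \<theta>)" using A by auto
        then show "{\<omega>\<in>space M. N \<omega> = n} \<in> sets (G (s n))"
          by (rule sets_G_mono[OF \<theta> ST_from_ST[OF sT] ST_from_le[OF sT]])
      qed
      moreover have "AE \<omega> in M. \<theta>' \<omega> \<le> \<tau>' \<omega>"
        using ST_from_le[OF \<tau>] AE_space
        by eventually_elim (use ST_bounds[OF \<theta>'] in \<open>auto simp: \<tau>'_def s_def N_def\<close>)
      ultimately have \<tau>': "\<tau>' \<in> STs_from \<theta>'" by (rule ST_from_I)
      have "AE \<omega> in M. \<omega> \<in> ?A \<longrightarrow> ecexp M (G \<theta>) (\<psi> \<tau>) \<omega> = ecexp M (G \<theta>') (\<psi> \<tau>') \<omega>"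
      proof (rule ecexp_local[OF sigma_finite_G[OF \<theta>] sigma_finite_G[OF \<theta>'] A A'])
        show "?A \<inter> B \<in> sets (G \<theta>')" if "B \<in> sets (G \<theta>)" for B
          using eq_Int_sets_G[OF \<theta> \<theta>' that] .
        show "?A \<inter> B \<in> sets (G \<theta>)" if "B \<in> sets (G \<theta>')" for B
          using eq_Int_sets_G[OF \<theta>' \<theta> that] by (simp add: eq_commute)
        show "\<psi> \<tau> \<in> borel_measurable M" "\<psi> \<tau>' \<in> borel_measurable M"
          using admissible_measurable_M[OF \<psi>] ST_from_ST \<tau> \<tau>' by auto
        show "AE \<omega> in M. \<omega> \<in> ?A \<longrightarrow> \<psi> \<tau> \<omega> = \<psi> \<tau>' \<omega>"
          using admissible_cong[OF \<psi> ST_from_ST[OF \<tau>] ST_from_ST[OF \<tau>']]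
          by eventually_elim (auto simp: \<tau>'_def s_def N_def)
      qed
      with snell_ge[OF v \<theta>' \<tau>'] AE_space
      show "AE \<omega> in M. ecexp M (G \<theta>) (\<psi> \<tau>) \<omega> \<le> (if \<theta> \<omega> = \<theta>' \<omega> then v \<theta>' \<omega> else \<infinity>)"
        by eventually_elim auto
    qed
    then show ?thesis by eventually_elim auto
  qed
  fix \<theta> \<theta>' assume "\<theta> \<in> STs" "\<theta>' \<in> STs"
  from le[OF this] le[OF this(2,1)]
  show "AE \<omega> in M. \<theta> \<omega> = \<theta>' \<omega> \<longrightarrow> v \<theta> \<omega> = v \<theta>' \<omega>"
    by eventually_elim auto
qed

text \<open>Almost everywhere some member of a countable maximising set pays more than
  \<open>u - \<epsilon>\<close>; the first such member is selected, and locality identifies the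
  conditional payoff of the pasted time. The finite minorant \<open>u\<close> replaces
  \<open>v \<theta>\<close>, which may be infinite and then has no finite tolerance.\<close>

lemma snell_eps_optimal:
  assumes \<psi>: "admissible M F T \<psi>" and v: "snell \<psi> v" and \<theta>: "\<theta> \<in> STs"
    and u: "u \<in> borel_measurable (G \<theta>)" "AE \<omega> in M. u \<omega> \<le> v \<theta> \<omega>" "AE \<omega> in M. \<bar>u \<omega>\<bar> \<noteq> \<infinity>"
    and \<epsilon>: "0 < (\<epsilon>::real)"
  obtains \<tau> where "\<tau> \<in> STs_from \<theta>" "AE \<omega> in M. u \<omega> - \<epsilon> \<le> ecexp M (G \<theta>) (\<psi> \<tau>) \<omega>"
proof -
  let ?X = "\<lambda>\<tau>. ecexp M (G \<theta>) (\<psi> \<tau>)"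
  obtain C where C: "C \<subseteq> STs_from \<theta>" "countable C"
      "AE \<omega> in M. v \<theta> \<omega> = (SUP \<tau>\<in>C. ?X \<tau> \<omega>)"
    using is_esssup_countable[OF snell_is_esssup[OF v \<theta>]] measurable_ecexp_M[OF \<theta>] by metis
  \<comment> \<open>Inserting \<open>\<theta>\<close> makes the set nonempty, so that the
    enumeration stays inside it.\<close>
  define s where "s = from_nat_into (insert \<theta> C)"
  have range_s: "range s = insert \<theta> C" unfolding s_def using C(2) by (intro range_from_nat_into) auto
  have s: "s n \<in> STs_from \<theta>" for n
    using range_s C(1) ST_from_refl[OF \<theta>] by (metis insert_subset rangeI subsetD)
  note sST = ST_from_ST[OF s]
  \<comment> \<open>The selection uses only information available at \<open>\<theta>\<close>. Points
    without a good index form a null set, so the unspecified value of \<open>LEAST\<close> there is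
    harmless.\<close>
  define N where "N \<omega> = (LEAST n. u \<omega> - ereal \<epsilon> \<le> ?X (s n) \<omega>)" for \<omega>
  note [measurable] = u(1) measurable_ecexp_G[OF \<theta>]
  have "N \<in> measurable (G \<theta>) (count_space UNIV)" unfolding N_def by measurable
  then have "{\<omega>\<in>space (G \<theta>). N \<omega> = n} \<in> sets (G \<theta>)" for n by measurable
  then have N: "{\<omega>\<in>space M. N \<omega> = n} \<in> sets (G \<theta>)" for n by (simp add: space_G)
  define \<tau> where "\<tau> = (\<lambda>\<omega>. s (N \<omega>) \<omega>)"
  have \<tau>ST: "\<tau> \<in> STs" unfolding \<tau>_def
    by (rule glue_ST[OF sST sets_G_mono[OF \<theta> sST ST_from_le[OF s] N]])
  have "AE \<omega> in M. \<forall>n. \<theta> \<omega> \<le> s n \<omega>"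
    using ST_from_le[OF s] by (simp add: AE_all_countable)
  then have "AE \<omega> in M. \<theta> \<omega> \<le> \<tau> \<omega>" by eventually_elim (simp add: \<tau>_def)
  with \<tau>ST have \<tau>: "\<tau> \<in> STs_from \<theta>" by (rule ST_from_I)
  have "AE \<omega> in M. \<omega> \<in> {\<omega>\<in>space M. N \<omega> = n} \<longrightarrow> ?X \<tau> \<omega> = ?X (s n) \<omega>" for n
  proof (rule ecexp_local[OF sigma_finite_G[OF \<theta>] sigma_finite_G[OF \<theta>] N N])
    show "\<psi> \<tau> \<in> borel_measurable M" "\<psi> (s n) \<in> borel_measurable M"
      using admissible_measurable_M[OF \<psi>] \<tau>ST sST by auto
    show "AE \<omega> in M. \<omega> \<in> {\<omega>\<in>space M. N \<omega> = n} \<longrightarrow> \<psi> \<tau> \<omega> = \<psi> (s n) \<omega>"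
      using admissible_cong[OF \<psi> \<tau>ST sST[of n]] by eventually_elim (auto simp: \<tau>_def)
  qed (use N in auto)
  then have "AE \<omega> in M. \<forall>n. \<omega> \<in> {\<omega>\<in>space M. N \<omega> = n} \<longrightarrow> ?X \<tau> \<omega> = ?X (s n) \<omega>"
    unfolding AE_all_countable by (rule allI)
  then have "AE \<omega> in M. u \<omega> - \<epsilon> \<le> ?X \<tau> \<omega>"
    using C(3) u(2,3) AE_space
  proof eventually_elim
    case (elim \<omega>)
    have "u \<omega> - \<epsilon> < u \<omega>" using elim(4) \<epsilon> by (cases "u \<omega>") auto
    also have "\<dots> \<le> (SUP n. ?X (s n) \<omega>)"
    proof -
      have "u \<omega> \<le> (SUP \<tau>\<in>C. ?X \<tau> \<omega>)" using elim by simp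
      also have "\<dots> \<le> (SUP \<tau>\<in>range s. ?X \<tau> \<omega>)"
        unfolding range_s by (intro SUP_subset_mono) auto
      finally show ?thesis by (simp add: image_image)
    qed
    finally obtain n where "u \<omega> - \<epsilon> < ?X (s n) \<omega>" by (auto simp: less_SUP_iff)
    then have "u \<omega> - \<epsilon> \<le> ?X (s (N \<omega>)) \<omega>"
      unfolding N_def by (intro LeastI[of "\<lambda>n. u \<omega> - ereal \<epsilon> \<le> ?X (s n) \<omega>" n]) simp
    moreover have "?X \<tau> \<omega> = ?X (s (N \<omega>)) \<omega>" using elim(1,5) by auto
    ultimately show ?case by simp
  qed
  with \<tau> show thesis by (rule that)
qed

lemma snell_dominates:
  assumes "admissible M F T \<psi>" "snell \<psi> v" "\<theta> \<in> STs"
  shows "AE \<omega> in M. \<psi> \<theta> \<omega> \<le> v \<theta> \<omega>"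
  using sigma_finite_subalgebra.ecexp_F_meas[OF sigma_finite_G admissible_measurable[OF assms(1)], OF assms(3,3)]
    snell_ge[OF assms(2,3) ST_from_refl[OF assms(3)]]
  by eventually_elim simp

text \<open>A near-optimal continuation after \<open>\<tau>\<close> is also a competitor after
  \<open>\<theta>\<close>, so the tower property bounds its payoff by \<open>v \<theta>\<close>.
  Finiteness of \<open>v\<close> cannot be presupposed, hence the argument runs for truncations and
  passes to the limit.\<close>

lemma snell_supermartingale:
  assumes \<psi>: "admissible M F T \<psi>" "\<And>\<tau>. \<tau> \<in> STs \<Longrightarrow> lower_integrable M (\<psi> \<tau>)"
    and v: "snell \<psi> v" "\<And>\<tau>. \<tau> \<in> STs \<Longrightarrow> AE \<omega> in M. 0 \<le> v \<tau> \<omega>"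
    and \<theta>: "\<theta> \<in> STs" and \<tau>: "\<tau> \<in> STs_from \<theta>"
  shows "AE \<omega> in M. ecexp M (G \<theta>) (v \<tau>) \<omega> \<le> v \<theta> \<omega>"
proof -
  interpret G: sigma_finite_subalgebra M "G \<theta>" by (rule sigma_finite_G[OF \<theta>])
  note \<tau>ST = ST_from_ST[OF \<tau>]
  note v_adm = admissible_snell[OF \<psi>(1) v(1)]
  note [measurable] = admissible_measurable_M[OF v_adm \<tau>ST] admissible_measurable[OF v_adm \<tau>ST]
  define u where "u k \<omega> = min (v \<tau> \<omega>) (ereal (real k))" for k \<omega>
  have u_meas [measurable]: "u k \<in> borel_measurable (G \<tau>)" "u k \<in> borel_measurable M" for k
    unfolding u_def by measurable
  \<comment> \<open>Truncation level and tolerance are tied together so that \<open>?W k\<close>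
    increases to \<open>v \<tau>\<close>. Nonnegativity of \<open>v \<tau>\<close> and a tolerance
    of at most 1 give the common lower bound -1.\<close>
  let ?W = "\<lambda>k \<omega>. u k \<omega> - ereal (inverse (Suc k))"
  have W_le: "AE \<omega> in M. -1 \<le> ?W k \<omega>" for k
    using v(2)[OF \<tau>ST]
  proof eventually_elim
    case (elim \<omega>)
    then have "0 \<le> u k \<omega>" by (simp add: u_def)
    moreover have "inverse (real (Suc k)) \<le> 1" by (simp add: field_simps)
    ultimately show ?case
      by (cases "u k \<omega>") (auto simp: one_ereal_def)
  qed
  show ?thesis
  proof (rule G.ecexp_SUP_le[where X = ?W])
    have "lower_integrable M (\<lambda>\<omega>. -1)"
      by (simp add: lower_integrable_def emeasure_space_1 one_ereal_def)
    then show "lower_integrable M (?W k)" for k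
      by (rule lower_integrable_AE_mono) (use W_le in auto)
    have mono: "?W k \<omega> \<le> ?W (Suc k) \<omega>" for k \<omega>
      unfolding u_def by (intro ereal_minus_mono min.mono) auto
    then show "AE \<omega> in M. ?W k \<omega> \<le> ?W (Suc k) \<omega>" for k by simp
    show "AE \<omega> in M. v \<tau> \<omega> = (SUP k. ?W k \<omega>)"
    proof (rule AE_I2)
      fix \<omega>
      have "(\<lambda>k. ereal (real k)) \<longlonglongrightarrow> \<infinity>"
        by (simp add: tendsto_PInfty_eq_at_top filterlim_real_sequentially)
      then have "(\<lambda>k. u k \<omega>) \<longlonglongrightarrow> min (v \<tau> \<omega>) \<infinity>"
        unfolding u_def by (intro tendsto_min tendsto_const)
      moreover have "(\<lambda>k. ereal (inverse (Suc k))) \<longlonglongrightarrow> ereal 0"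
        unfolding lim_ereal by (rule LIMSEQ_inverse_real_of_nat)
      ultimately have "(\<lambda>k. ?W k \<omega>) \<longlonglongrightarrow> min (v \<tau> \<omega>) \<infinity> - ereal 0"
        by (intro tendsto_diff_ereal_general) auto
      moreover have "(\<lambda>k. ?W k \<omega>) \<longlonglongrightarrow> (SUP k. ?W k \<omega>)"
        by (intro LIMSEQ_SUP incseq_SucI mono)
      ultimately show "v \<tau> \<omega> = (SUP k. ?W k \<omega>)"
        by (metis LIMSEQ_unique ereal_infty_less_eq(1) ereal_minus(7) min.absorb1 ereal_less_eq(1) zero_ereal_def)
    qed
    fix k
    have "AE \<omega> in M. \<bar>u k \<omega>\<bar> \<noteq> \<infinity>"
      using v(2)[OF \<tau>ST]
    proof eventually_elim
      case (elim \<omega>)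
      then show ?case unfolding u_def by (cases "v \<tau> \<omega>") (auto simp: min_def)
    qed
    note u_fin = this
    have u_le: "AE \<omega> in M. u k \<omega> \<le> v \<tau> \<omega>" by (simp add: u_def)
    have pos: "0 < inverse (real (Suc k))" by simp
    obtain \<rho> where \<rho>: "\<rho> \<in> STs_from \<tau>" "AE \<omega> in M. ?W k \<omega> \<le> ecexp M (G \<tau>) (\<psi> \<rho>) \<omega>"
      by (rule snell_eps_optimal[OF \<psi>(1) v(1) \<tau>ST u_meas(1) u_le u_fin pos])
    have "AE \<omega> in M. ecexp M (G \<theta>) (?W k) \<omega> \<le> ecexp M (G \<theta>) (ecexp M (G \<tau>) (\<psi> \<rho>)) \<omega>"
      using \<rho>(2) measurable_ecexp_M[OF \<tau>ST] by (intro G.ecexp_mono) auto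
    moreover have "AE \<omega> in M. ecexp M (G \<theta>) (ecexp M (G \<tau>) (\<psi> \<rho>)) \<omega> = ecexp M (G \<theta>) (\<psi> \<rho>) \<omega>"
      by (intro G.ecexp_tower \<psi>(2) subalgebra_G subalgebra_G_G \<tau>ST \<theta> ST_from_ST[OF \<rho>(1)] ST_from_le[OF \<tau>])
    moreover note snell_ge[OF v(1) \<theta> ST_from_trans[OF \<tau> \<rho>(1)]]
    ultimately show "AE \<omega> in M. ecexp M (G \<theta>) (?W k) \<omega> \<le> v \<theta> \<omega>"
      by eventually_elim simp
  qed simp
qed

end

context usual_filtered_space
begin

lemma admissible_add:
  assumes "admissible M F T \<phi>" "admissible M F T a"
  shows "admissible M F T (\<lambda>\<tau> \<omega>. \<phi> \<tau> \<omega> + a \<tau> \<omega>)"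
  unfolding admissible_def
proof (intro conjI ballI)
  fix \<theta> assume \<theta>: "\<theta> \<in> STs"
  show "(\<lambda>\<omega>. \<phi> \<theta> \<omega> + a \<theta> \<omega>) \<in> borel_measurable (G \<theta>)"
    using admissible_measurable[OF assms(1) \<theta>] admissible_measurable[OF assms(2) \<theta>] by measurable
  fix \<theta>' assume \<theta>': "\<theta>' \<in> STs"
  show "AE \<omega> in M. \<theta> \<omega> = \<theta>' \<omega> \<longrightarrow> \<phi> \<theta> \<omega> + a \<theta> \<omega> = \<phi> \<theta>' \<omega> + a \<theta>' \<omega>"
    using admissible_cong[OF assms(1) \<theta> \<theta>'] admissible_cong[OF assms(2) \<theta> \<theta>']
    by eventually_elim auto
qed

lemma admissible_uminus:
  assumes "admissible M F T a"
  shows "admissible M F T (\<lambda>\<tau> \<omega>. - a \<tau> \<omega>)"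
  using assms unfolding admissible_def by fastforce

text \<open>Waiting until \<open>T\<close> is always allowed and pays a nonnegative amount.\<close>

lemma snell_nonneg:
  assumes \<psi>: "admissible M F T \<psi>" "AE \<omega> in M. 0 \<le> \<psi> (\<lambda>_. T) \<omega>" and v: "snell \<psi> v" and \<theta>: "\<theta> \<in> STs"
  shows "AE \<omega> in M. 0 \<le> v \<theta> \<omega>"
proof -
  interpret G: sigma_finite_subalgebra M "G \<theta>" by (rule sigma_finite_G[OF \<theta>])
  have "\<psi> (\<lambda>_. T) \<in> borel_measurable M"
    by (rule admissible_measurable_M[OF \<psi>(1) ST_from_ST[OF ST_from_T[OF \<theta>]]])
  from G.ecexp_nonneg[OF this \<psi>(2)] snell_ge[OF v \<theta> ST_from_T[OF \<theta>]]
  show ?thesis by eventually_elim (metis enn2ereal_nonneg order_trans)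
qed

lemma snell_mono:
  assumes \<psi>: "admissible M F T \<psi>" "admissible M F T \<psi>'" and v: "snell \<psi> v" "snell \<psi>' v'"
    and le: "\<And>\<tau>. \<tau> \<in> STs \<Longrightarrow> AE \<omega> in M. \<psi> \<tau> \<omega> \<le> \<psi>' \<tau> \<omega>" and \<theta>: "\<theta> \<in> STs"
  shows "AE \<omega> in M. v \<theta> \<omega> \<le> v' \<theta> \<omega>"
proof (rule snell_le[OF v(1) \<theta>])
  interpret G: sigma_finite_subalgebra M "G \<theta>" by (rule sigma_finite_G[OF \<theta>])
  show "v' \<theta> \<in> borel_measurable M" by (rule admissible_measurable_M[OF admissible_snell[OF \<psi>(2) v(2)] \<theta>])
  fix \<tau> assume \<tau>: "\<tau> \<in> STs_from \<theta>"
  note \<tau>ST = ST_from_ST[OF \<tau>]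
  have "AE \<omega> in M. ecexp M (G \<theta>) (\<psi> \<tau>) \<omega> \<le> ecexp M (G \<theta>) (\<psi>' \<tau>) \<omega>"
    by (intro G.ecexp_mono admissible_measurable_M[OF _ \<tau>ST] \<psi> le \<tau>ST)
  with snell_ge[OF v(2) \<theta> \<tau>] show "AE \<omega> in M. ecexp M (G \<theta>) (\<psi> \<tau>) \<omega> \<le> v' \<theta> \<omega>"
    by eventually_elim simp
qed

text \<open>Increasing limits commute with the envelope: conditional monotone convergence makes
  \<open>V\<close> an upper bound, and any upper bound for the limiting reward dominates each
  \<open>v (Suc n)\<close>. The index shift matches the recursion that defines the iterates.\<close>

lemma snell_SUP:
  fixes \<phi> v :: "nat \<Rightarrow> 'a family"
  assumes a: "admissible M F T a" "\<And>\<tau>. \<tau> \<in> STs \<Longrightarrow> lower_integrable M (a \<tau>)"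
    and \<phi>: "\<And>n. admissible M F T (\<phi> n)" "\<And>n \<tau>. \<tau> \<in> STs \<Longrightarrow> AE \<omega> in M. 0 \<le> \<phi> n \<tau> \<omega>"
      "\<And>n \<tau>. \<tau> \<in> STs \<Longrightarrow> AE \<omega> in M. \<phi> n \<tau> \<omega> \<le> \<phi> (Suc n) \<tau> \<omega>"
    and \<Phi>: "admissible M F T \<Phi>" "\<And>\<tau>. \<tau> \<in> STs \<Longrightarrow> AE \<omega> in M. \<Phi> \<tau> \<omega> = (SUP n. \<phi> n \<tau> \<omega>)"
    and v: "\<And>n. snell (\<lambda>\<tau> \<omega>. \<phi> n \<tau> \<omega> + a \<tau> \<omega>) (v (Suc n))"
      "\<And>n \<tau>. \<tau> \<in> STs \<Longrightarrow> AE \<omega> in M. v n \<tau> \<omega> \<le> v (Suc n) \<tau> \<omega>"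
    and V: "admissible M F T V" "\<And>\<tau>. \<tau> \<in> STs \<Longrightarrow> AE \<omega> in M. V \<tau> \<omega> = (SUP n. v n \<tau> \<omega>)"
  shows "snell (\<lambda>\<tau> \<omega>. \<Phi> \<tau> \<omega> + a \<tau> \<omega>) V"
  unfolding snell_def is_esssup_def
proof (intro ballI conjI impI)
  fix \<theta> assume \<theta>: "\<theta> \<in> STs"
  interpret G: sigma_finite_subalgebra M "G \<theta>" by (rule sigma_finite_G[OF \<theta>])
  show "V \<theta> \<in> borel_measurable M" by (rule admissible_measurable_M[OF V(1) \<theta>])
  note adm\<Phi> = admissible_add[OF \<Phi>(1) a(1)]
  have V_ge: "AE \<omega> in M. v n \<theta> \<omega> \<le> V \<theta> \<omega>" for n
    using V(2)[OF \<theta>] by eventually_elim (auto intro: SUP_upper)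
  fix \<tau> assume \<tau>: "\<tau> \<in> STs_from \<theta>"
  note \<tau>ST = ST_from_ST[OF \<tau>]
  show "AE \<omega> in M. ecexp M (G \<theta>) (\<lambda>\<omega>. \<Phi> \<tau> \<omega> + a \<tau> \<omega>) \<omega> \<le> V \<theta> \<omega>"
  proof (rule G.ecexp_SUP_le[where X = "\<lambda>n \<omega>. \<phi> n \<tau> \<omega> + a \<tau> \<omega>"])
    show "lower_integrable M (\<lambda>\<omega>. \<phi> n \<tau> \<omega> + a \<tau> \<omega>)" for n
      by (intro lower_integrable_add lower_integrable_nonneg a(2) \<phi>(2) \<tau>ST
          admissible_measurable_M[OF \<phi>(1) \<tau>ST])
    show "AE \<omega> in M. \<phi> n \<tau> \<omega> + a \<tau> \<omega> \<le> \<phi> (Suc n) \<tau> \<omega> + a \<tau> \<omega>" for n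
      using \<phi>(3)[OF \<tau>ST, of n] by eventually_elim (rule add_right_mono)
    show "(\<lambda>\<omega>. \<Phi> \<tau> \<omega> + a \<tau> \<omega>) \<in> borel_measurable M"
      by (rule admissible_measurable_M[OF adm\<Phi> \<tau>ST])
    show "AE \<omega> in M. \<Phi> \<tau> \<omega> + a \<tau> \<omega> = (SUP n. \<phi> n \<tau> \<omega> + a \<tau> \<omega>)"
      using \<Phi>(2)[OF \<tau>ST] lower_integrable_AE_finite[OF a(2)[OF \<tau>ST]]
      by eventually_elim (simp add: SUP_ereal_add_left)
    show "AE \<omega> in M. ecexp M (G \<theta>) (\<lambda>\<omega>. \<phi> n \<tau> \<omega> + a \<tau> \<omega>) \<omega> \<le> V \<theta> \<omega>" for n
      using snell_ge[OF v(1)[of n] \<theta> \<tau>] V_ge[of "Suc n"] by eventually_elim simp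
  qed
next
  fix \<theta> Z assume \<theta>: "\<theta> \<in> STs" and Z: "Z \<in> borel_measurable M"
    "\<forall>\<tau>\<in>STs_from \<theta>. AE \<omega> in M. ecexp M (G \<theta>) (\<lambda>\<omega>. \<Phi> \<tau> \<omega> + a \<tau> \<omega>) \<omega> \<le> Z \<omega>"
  interpret G: sigma_finite_subalgebra M "G \<theta>" by (rule sigma_finite_G[OF \<theta>])
  note adm\<phi> = admissible_add[OF \<phi>(1) a(1)] and adm\<Phi> = admissible_add[OF \<Phi>(1) a(1)]
  have Suc: "AE \<omega> in M. v (Suc n) \<theta> \<omega> \<le> Z \<omega>" for n
  proof (rule snell_le[OF v(1) \<theta> Z(1)])
    fix \<tau> assume \<tau>: "\<tau> \<in> STs_from \<theta>"
    note \<tau>ST = ST_from_ST[OF \<tau>]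
    have "AE \<omega> in M. ecexp M (G \<theta>) (\<lambda>\<omega>. \<phi> n \<tau> \<omega> + a \<tau> \<omega>) \<omega> \<le> ecexp M (G \<theta>) (\<lambda>\<omega>. \<Phi> \<tau> \<omega> + a \<tau> \<omega>) \<omega>"
    proof (rule G.ecexp_mono)
      show "AE \<omega> in M. \<phi> n \<tau> \<omega> + a \<tau> \<omega> \<le> \<Phi> \<tau> \<omega> + a \<tau> \<omega>"
        using \<Phi>(2)[OF \<tau>ST] by eventually_elim (auto intro!: add_right_mono SUP_upper)
    qed (rule admissible_measurable_M[OF adm\<phi> \<tau>ST] admissible_measurable_M[OF adm\<Phi> \<tau>ST])+
    with Z(2)[rule_format, OF \<tau>]
    show "AE \<omega> in M. ecexp M (G \<theta>) (\<lambda>\<omega>. \<phi> n \<tau> \<omega> + a \<tau> \<omega>) \<omega> \<le> Z \<omega>"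
      by eventually_elim simp
  qed
  \<comment> \<open>The starting family \<open>v 0\<close> is not assumed to be an envelope; it is
    covered by \<open>v 0 \<le> v 1\<close>.\<close>
  have "AE \<omega> in M. v n \<theta> \<omega> \<le> Z \<omega>" for n
    using Suc[of n] v(2)[OF \<theta>, of n] by eventually_elim simp
  then have "AE \<omega> in M. \<forall>n. v n \<theta> \<omega> \<le> Z \<omega>" unfolding AE_all_countable by (rule allI)
  with V(2)[OF \<theta>] show "AE \<omega> in M. V \<theta> \<omega> \<le> Z \<omega>"
    by eventually_elim (auto intro: SUP_least)
qed

lemma admissible_limsup:
  assumes "\<And>n::nat. admissible M F T (\<phi> n)"
  shows "admissible M F T (\<lambda>\<theta> \<omega>. limsup (\<lambda>n. \<phi> n \<theta> \<omega>))"
  unfolding admissible_def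
proof (intro conjI ballI)
  fix \<theta> assume \<theta>: "\<theta> \<in> STs"
  show "(\<lambda>\<omega>. limsup (\<lambda>n. \<phi> n \<theta> \<omega>)) \<in> borel_measurable (G \<theta>)"
    using admissible_measurable[OF assms \<theta>] by measurable
  fix \<theta>' assume \<theta>': "\<theta>' \<in> STs"
  have "AE \<omega> in M. \<forall>n. \<theta> \<omega> = \<theta>' \<omega> \<longrightarrow> \<phi> n \<theta> \<omega> = \<phi> n \<theta>' \<omega>"
    unfolding AE_all_countable using admissible_cong[OF assms \<theta> \<theta>'] by (rule allI)
  then show "AE \<omega> in M. \<theta> \<omega> = \<theta>' \<omega> \<longrightarrow> limsup (\<lambda>n. \<phi> n \<theta> \<omega>) = limsup (\<lambda>n. \<phi> n \<theta>' \<omega>)"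
    by eventually_elim simp
qed

lemma AE_limsup_eq_SUP:
  fixes f :: "nat \<Rightarrow> 'a \<Rightarrow> ereal"
  assumes "\<And>n. AE \<omega> in M. f n \<omega> \<le> f (Suc n) \<omega>"
  shows "AE \<omega> in M. limsup (\<lambda>n. f n \<omega>) = (SUP n. f n \<omega>)"
proof -
  have "AE \<omega> in M. \<forall>n. f n \<omega> \<le> f (Suc n) \<omega>"
    unfolding AE_all_countable using assms by (rule allI)
  then show ?thesis
  proof eventually_elim
    case (elim \<omega>)
    then have "(\<lambda>n. f n \<omega>) \<longlonglongrightarrow> (SUP n. f n \<omega>)" by (intro LIMSEQ_SUP incseq_SucI) simp
    then show ?case by (intro lim_imp_Limsup) auto
  qed
qed

text \<open>The level sets \<open>{f \<le> k}\<close> have probability 0 or 1 and exhaust the space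
  up to a null set, so one of them has probability 1.\<close>

lemma AE_bounded_of_trivial:
  assumes triv: "\<forall>A\<in>sets (F 0). measure M A = 0 \<or> measure M A = 1"
    and f: "f \<in> borel_measurable (G (\<lambda>_. 0))" "AE \<omega> in M. f \<omega> < (\<infinity>::ereal)"
  obtains k :: nat where "AE \<omega> in M. f \<omega> \<le> ereal (real k)"
proof -
  have ST0: "(\<lambda>_. 0) \<in> STs" using T_pos by (intro const_ST) auto
  define A where "A k = {\<omega>\<in>space M. f \<omega> \<le> ereal (real k)}" for k :: nat
  have "{\<omega>\<in>space (G (\<lambda>_. 0)). f \<omega> \<le> ereal (real k)} \<in> sets (G (\<lambda>_. 0))" for k
    using f(1) by measurable
  then have A: "A k \<in> sets (G (\<lambda>_. 0))" for k by (simp add: A_def space_G)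
  have AM: "A k \<in> sets M" for k using A[of k] by (simp add: sets_G[OF ST0])
  \<comment> \<open>The case t = 0 of membership in \<open>G (\<lambda>_. 0)\<close>, which brings
    the sets down to \<open>F 0\<close>.\<close>
  have "A k \<inter> {\<omega>\<in>space M. (0::real) \<le> 0} \<in> sets (F 0)" for k
    using A[of k] T_pos by (auto simp: sets_G[OF ST0])
  moreover have "A k \<inter> {\<omega>\<in>space M. (0::real) \<le> 0} = A k" for k by (auto simp: A_def)
  ultimately have A0: "measure M (A k) = 0 \<or> measure M (A k) = 1" for k using triv by auto
  have "\<exists>k. measure M (A k) \<noteq> 0"
  proof (rule ccontr)
    assume "\<nexists>k. measure M (A k) \<noteq> 0"
    then have "A k \<in> null_sets M" for k using AM by (auto simp: null_sets_def emeasure_eq_measure)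
    then have "AE \<omega> in M. \<forall>k. \<omega> \<notin> A k"
      unfolding AE_all_countable using AE_not_in by blast
    with f(2) AE_space have "AE \<omega> in M. False"
    proof eventually_elim
      case (elim \<omega>)
      obtain k :: nat where "real_of_ereal (f \<omega>) \<le> real k" using real_arch_simple by blast
      then have "f \<omega> \<le> ereal (real k)" using elim(1) by (cases "f \<omega>") auto
      with elim(2,3) show ?case by (auto simp: A_def)
    qed
    then show False by simp
  qed
  then obtain k where "measure M (A k) = 1" using A0 by auto
  then have "AE \<omega> in M. \<omega> \<in> A k" using AM by (simp add: prob_eq_1)
  then have "AE \<omega> in M. f \<omega> \<le> ereal (real k)" by eventually_elim (simp add: A_def)
  then show thesis by (rule that)
qed

lemma min_ST_from:
  assumes "\<tau> \<in> STs_from \<theta>" "\<sigma> \<in> STs_from \<theta>"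
  shows "(\<lambda>\<omega>. min (\<tau> \<omega>) (\<sigma> \<omega>)) \<in> STs_from \<theta>"
  using ST_from_le[OF assms(1)] ST_from_le[OF assms(2)]
  by (intro ST_from_I min_ST ST_from_ST[OF assms(1)] ST_from_ST[OF assms(2)], eventually_elim) auto

text \<open>The supermartingale inequality at \<open>\<rho>\<close>, seen from the earlier time
  \<open>\<theta>\<close>; the game argument uses it with \<open>\<rho>\<close> the minimum of both
  players' times.\<close>

lemma snell_ecexp_antimono:
  assumes \<psi>: "admissible M F T \<psi>" "\<And>\<tau>. \<tau> \<in> STs \<Longrightarrow> lower_integrable M (\<psi> \<tau>)"
    and v: "snell \<psi> v" "\<And>\<tau>. \<tau> \<in> STs \<Longrightarrow> AE \<omega> in M. 0 \<le> v \<tau> \<omega>"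
    and \<theta>: "\<theta> \<in> STs" and \<rho>: "\<rho> \<in> STs_from \<theta>" and \<tau>: "\<tau> \<in> STs_from \<rho>"
  shows "AE \<omega> in M. ecexp M (G \<theta>) (v \<tau>) \<omega> \<le> ecexp M (G \<theta>) (v \<rho>) \<omega>"
proof -
  interpret G: sigma_finite_subalgebra M "G \<theta>" by (rule sigma_finite_G[OF \<theta>])
  note \<rho>ST = ST_from_ST[OF \<rho>] and \<tau>ST = ST_from_ST[OF \<tau>]
  note vM = admissible_measurable_M[OF admissible_snell[OF \<psi>(1) v(1)]]
  have "AE \<omega> in M. ecexp M (G \<theta>) (ecexp M (G \<rho>) (v \<tau>)) \<omega> \<le> ecexp M (G \<theta>) (v \<rho>) \<omega>"
    by (intro G.ecexp_mono measurable_ecexp_M vM \<rho>ST snell_supermartingale[OF \<psi> v \<rho>ST \<tau>])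
  moreover have "AE \<omega> in M. ecexp M (G \<theta>) (ecexp M (G \<rho>) (v \<tau>)) \<omega> = ecexp M (G \<theta>) (v \<tau>) \<omega>"
    by (intro G.ecexp_tower lower_integrable_nonneg vM v(2) \<tau>ST \<rho>ST subalgebra_G
        subalgebra_G_G \<theta> ST_from_le[OF \<rho>])
  ultimately show ?thesis by eventually_elim simp
qed

end

subsection \<open>The game for a Snell system\<close>

locale dynkin_game = usual_filtered_space M F T
  for M :: "'a measure" and F T +
  fixes \<xi> \<zeta> :: "'a family"
  assumes adm_\<xi>: "admissible M F T \<xi>" and adm_\<zeta>: "admissible M F T \<zeta>"
    and li_\<xi>: "\<And>\<tau>. \<tau> \<in> STs \<Longrightarrow> lower_integrable M (\<xi> \<tau>)"
    and li_\<zeta>: "\<And>\<tau>. \<tau> \<in> STs \<Longrightarrow> lower_integrable M (\<lambda>\<omega>. - \<zeta> \<tau> \<omega>)"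

text \<open>Collects what the game argument needs from the two families, separately from their
  construction as limits. The difference is written \<open>+ - \<zeta>\<close> so that both rewards
  are sums and share the same lemmas.\<close>

locale snell_system = dynkin_game M F T \<xi> \<zeta>
  for M :: "'a measure" and F T \<xi> \<zeta> +
  fixes J J' :: "'a family"
  assumes adm_J: "admissible M F T J" and adm_J': "admissible M F T J'"
    and J_nonneg: "\<And>\<tau>. \<tau> \<in> STs \<Longrightarrow> AE \<omega> in M. 0 \<le> J \<tau> \<omega>"
    and J'_nonneg: "\<And>\<tau>. \<tau> \<in> STs \<Longrightarrow> AE \<omega> in M. 0 \<le> J' \<tau> \<omega>"
    and snell_J: "snell (\<lambda>\<tau> \<omega>. J' \<tau> \<omega> + \<xi> \<tau> \<omega>) J"
    and snell_J': "snell (\<lambda>\<tau> \<omega>. J \<tau> \<omega> + - \<zeta> \<tau> \<omega>) J'"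
    and int_J: "\<And>\<tau>. \<tau> \<in> STs \<Longrightarrow> (\<integral>\<^sup>+ \<omega>. e2ennreal (J \<tau> \<omega>) \<partial>M) < \<infinity>"
begin

lemmas adm_\<psi> = admissible_add[OF adm_J' adm_\<xi>]
lemmas adm_\<psi>' = admissible_add[OF adm_J admissible_uminus[OF adm_\<zeta>]]
lemmas meas_J = admissible_measurable_M[OF adm_J]
lemmas meas_J' = admissible_measurable_M[OF adm_J']

lemma li_J: "\<tau> \<in> STs \<Longrightarrow> lower_integrable M (J \<tau>)"
  and li_J': "\<tau> \<in> STs \<Longrightarrow> lower_integrable M (J' \<tau>)"
  by (intro lower_integrable_nonneg meas_J meas_J' J_nonneg J'_nonneg; assumption)+

lemma li_\<psi>: "\<tau> \<in> STs \<Longrightarrow> lower_integrable M (\<lambda>\<omega>. J' \<tau> \<omega> + \<xi> \<tau> \<omega>)"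
  and li_\<psi>': "\<tau> \<in> STs \<Longrightarrow> lower_integrable M (\<lambda>\<omega>. J \<tau> \<omega> + - \<zeta> \<tau> \<omega>)"
  by (intro lower_integrable_add li_J li_J' li_\<xi> li_\<zeta>; assumption)+

lemmas dom_J = snell_dominates[OF adm_\<psi> snell_J]
lemmas dom_J' = snell_dominates[OF adm_\<psi>' snell_J']

lemma J_supermartingale:
  "\<theta> \<in> STs \<Longrightarrow> \<tau> \<in> STs_from \<theta> \<Longrightarrow> AE \<omega> in M. ecexp M (G \<theta>) (J \<tau>) \<omega> \<le> J \<theta> \<omega>"
  by (rule snell_supermartingale[OF adm_\<psi> li_\<psi> snell_J J_nonneg])

lemma J_antimono:
  "\<theta> \<in> STs \<Longrightarrow> \<rho> \<in> STs_from \<theta> \<Longrightarrow> \<tau> \<in> STs_from \<rho>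
    \<Longrightarrow> AE \<omega> in M. ecexp M (G \<theta>) (J \<tau>) \<omega> \<le> ecexp M (G \<theta>) (J \<rho>) \<omega>"
  by (rule snell_ecexp_antimono[OF adm_\<psi> li_\<psi> snell_J J_nonneg])

lemma J'_supermartingale:
  "\<theta> \<in> STs \<Longrightarrow> \<tau> \<in> STs_from \<theta> \<Longrightarrow> AE \<omega> in M. ecexp M (G \<theta>) (J' \<tau>) \<omega> \<le> J' \<theta> \<omega>"
  by (rule snell_supermartingale[OF adm_\<psi>' li_\<psi>' snell_J' J'_nonneg])

lemma J'_antimono:
  "\<theta> \<in> STs \<Longrightarrow> \<rho> \<in> STs_from \<theta> \<Longrightarrow> \<tau> \<in> STs_from \<rho>
    \<Longrightarrow> AE \<omega> in M. ecexp M (G \<theta>) (J' \<tau>) \<omega> \<le> ecexp M (G \<theta>) (J' \<rho>) \<omega>"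
  by (rule snell_ecexp_antimono[OF adm_\<psi>' li_\<psi>' snell_J' J'_nonneg])

text \<open>Domination \<open>J' + \<xi> \<le> J\<close> bounds \<open>J'\<close> by
  \<open>J\<close> plus the negative part of \<open>\<xi>\<close>.\<close>

lemma int_J':
  assumes \<tau>: "\<tau> \<in> STs" shows "(\<integral>\<^sup>+ \<omega>. e2ennreal (J' \<tau> \<omega>) \<partial>M) < \<infinity>"
proof -
  note [measurable] = meas_J[OF \<tau>] admissible_measurable_M[OF adm_\<xi> \<tau>]
  have "(\<integral>\<^sup>+ \<omega>. e2ennreal (J' \<tau> \<omega>) \<partial>M) \<le> (\<integral>\<^sup>+ \<omega>. e2ennreal (J \<tau> \<omega>) + e2ennreal (- \<xi> \<tau> \<omega>) \<partial>M)"
    using dom_J[OF \<tau>] lower_integrable_AE_finite[OF li_\<xi>[OF \<tau>]] J'_nonneg[OF \<tau>]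
  proof (intro nn_integral_mono_AE, eventually_elim)
    case (elim \<omega>)
    then have "J' \<tau> \<omega> \<le> J \<tau> \<omega> + - \<xi> \<tau> \<omega>"
      by (cases "J' \<tau> \<omega>"; cases "J \<tau> \<omega>"; cases "\<xi> \<tau> \<omega>") auto
    then show ?case by (meson e2ennreal_mono e2ennreal_add_le order_trans)
  qed
  also have "\<dots> = (\<integral>\<^sup>+ \<omega>. e2ennreal (J \<tau> \<omega>) \<partial>M) + (\<integral>\<^sup>+ \<omega>. e2ennreal (- \<xi> \<tau> \<omega>) \<partial>M)"
    by (intro nn_integral_add) auto
  also have "\<dots> < \<infinity>"
    using int_J[OF \<tau>] li_\<xi>[OF \<tau>] by (auto simp: lower_integrable_def)
  finally show ?thesis .
qed

lemma J_finite: "\<tau> \<in> STs \<Longrightarrow> AE \<omega> in M. \<bar>J \<tau> \<omega>\<bar> \<noteq> \<infinity>"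
  using AE_less_infty_of_nn_integral[OF meas_J int_J] J_nonneg by (fastforce elim: eventually_elim2)

lemma J'_finite: "\<tau> \<in> STs \<Longrightarrow> AE \<omega> in M. \<bar>J' \<tau> \<omega>\<bar> \<noteq> \<infinity>"
  using AE_less_infty_of_nn_integral[OF meas_J' int_J'] J'_nonneg by (fastforce elim: eventually_elim2)

text \<open>From \<open>J - \<zeta> \<le> J'\<close> and \<open>J \<ge> 0\<close> follows
  \<open>- J' \<le> \<zeta>\<close>, and \<open>J'\<close> is integrable. This gives the payoff an
  integrable negative part.\<close>

lemma li_\<zeta>_pos:
  assumes \<tau>: "\<tau> \<in> STs" shows "lower_integrable M (\<zeta> \<tau>)"
proof (rule lower_integrable_AE_mono)
  show "lower_integrable M (\<lambda>\<omega>. - J' \<tau> \<omega>)"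
    using int_J'[OF \<tau>] meas_J'[OF \<tau>] by (simp add: lower_integrable_def)
  show "\<zeta> \<tau> \<in> borel_measurable M" by (rule admissible_measurable_M[OF adm_\<zeta> \<tau>])
  show "AE \<omega> in M. - J' \<tau> \<omega> \<le> \<zeta> \<tau> \<omega>"
    using dom_J'[OF \<tau>] J_nonneg[OF \<tau>]
  proof eventually_elim
    case (elim \<omega>)
    have "- \<zeta> \<tau> \<omega> \<le> J \<tau> \<omega> + - \<zeta> \<tau> \<omega>" using elim by (simp add: add_increasing)
    then have "- \<zeta> \<tau> \<omega> \<le> J' \<tau> \<omega>" using elim by simp
    then show ?case by (simp add: ereal_uminus_le_reorder)
  qed
qed

abbreviation payoff :: "'a stime \<Rightarrow> 'a stime \<Rightarrow> 'a \<Rightarrow> ereal" where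
  "payoff \<tau> \<sigma> \<equiv> \<lambda>\<omega>. if \<tau> \<omega> \<le> \<sigma> \<omega> then \<xi> \<tau> \<omega> else \<zeta> \<sigma> \<omega>"

lemma li_payoff:
  assumes "\<tau> \<in> STs" "\<sigma> \<in> STs" shows "lower_integrable M (payoff \<tau> \<sigma>)"
proof -
  note [measurable] = ST_measurable[OF assms(1)] ST_measurable[OF assms(2)]
  show ?thesis by (rule lower_integrable_if[OF li_\<xi>[OF assms(1)] li_\<zeta>_pos[OF assms(2)]]) measurable
qed

text \<open>Where \<open>\<tau> \<le> \<sigma>\<close> the first inequality is an equality and the second one is the
  sum of the two domination properties \<open>J - \<zeta> \<le> J'\<close> at \<open>\<sigma>\<close> and \<open>J' + \<xi> \<le> J\<close> at \<open>\<tau>\<close>;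
  elsewhere the roles are exchanged. All terms are arranged so that no difference of
  possibly infinite quantities occurs.\<close>

lemma game_AE:
  assumes \<tau>: "\<tau> \<in> STs" and \<sigma>: "\<sigma> \<in> STs"
  defines "\<rho> \<equiv> \<lambda>\<omega>. min (\<tau> \<omega>) (\<sigma> \<omega>)"
  shows "AE \<omega> in M. (J' \<tau> \<omega> + \<xi> \<tau> \<omega>) + J \<rho> \<omega> \<le> (payoff \<tau> \<sigma> \<omega> + J' \<rho> \<omega>) + J \<tau> \<omega>"
    and "AE \<omega> in M. ((J \<sigma> \<omega> + - \<zeta> \<sigma> \<omega>) + J' \<rho> \<omega>) + payoff \<tau> \<sigma> \<omega> \<le> J \<rho> \<omega> + J' \<sigma> \<omega>"
proof -
  have \<rho>: "\<rho> \<in> STs" unfolding \<rho>_def by (rule min_ST[OF \<tau> \<sigma>])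
  note facts = dom_J[OF \<tau>] dom_J'[OF \<tau>] dom_J[OF \<sigma>] dom_J'[OF \<sigma>]
    J_finite[OF \<tau>] J'_finite[OF \<tau>] J_finite[OF \<sigma>] J'_finite[OF \<sigma>]
    lower_integrable_AE_finite[OF li_\<xi>[OF \<tau>]] lower_integrable_AE_finite[OF li_\<zeta>[OF \<sigma>]]
    admissible_cong[OF adm_J \<rho> \<tau>] admissible_cong[OF adm_J \<rho> \<sigma>]
    admissible_cong[OF adm_J' \<rho> \<tau>] admissible_cong[OF adm_J' \<rho> \<sigma>]
  \<comment> \<open>Here and in \<open>**\<close> two dominations are added; the finiteness premises
    license moving terms across the inequality.\<close>
  have *: "x + y \<le> (z + w) + u" if "x \<le> u" "y + - z \<le> w" "\<bar>y\<bar> \<noteq> \<infinity>" "\<bar>w\<bar> \<noteq> \<infinity>" "- z \<noteq> -\<infinity>"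
    for x y z w u :: ereal
    using that by (cases x; cases y; cases z; cases w; cases u) auto
  have **: "(x + w) + z \<le> y + u" if "x \<le> u" "w + z \<le> y" "\<bar>y\<bar> \<noteq> \<infinity>" "\<bar>w\<bar> \<noteq> \<infinity>" "z \<noteq> -\<infinity>"
    for x y z w u :: ereal
    using that by (cases x; cases y; cases z; cases w; cases u) auto
  show "AE \<omega> in M. (J' \<tau> \<omega> + \<xi> \<tau> \<omega>) + J \<rho> \<omega> \<le> (payoff \<tau> \<sigma> \<omega> + J' \<rho> \<omega>) + J \<tau> \<omega>"
    using facts
  proof eventually_elim
    case (elim \<omega>)
    show ?case
    proof (cases "\<tau> \<omega> \<le> \<sigma> \<omega>")
      case True
      then have "\<rho> \<omega> = \<tau> \<omega>" by (simp add: \<rho>_def)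
      with True elim(11,13) show ?thesis by (simp add: add.commute)
    next
      case False
      then have "\<rho> \<omega> = \<sigma> \<omega>" by (simp add: \<rho>_def)
      then have eq: "J \<rho> \<omega> = J \<sigma> \<omega>" "J' \<rho> \<omega> = J' \<sigma> \<omega>" using elim(12,14) by auto
      show ?thesis using False unfolding eq
        using *[OF elim(1) elim(4) elim(7,8) elim(10)] by simp
    qed
  qed
  \<comment> \<open>Where \<open>\<sigma> < \<tau>\<close> the payoff must cancel
    \<open>- \<zeta> \<sigma>\<close>, so \<open>\<zeta> \<sigma>\<close> has to be finite from both
    sides.\<close>
  show "AE \<omega> in M. ((J \<sigma> \<omega> + - \<zeta> \<sigma> \<omega>) + J' \<rho> \<omega>) + payoff \<tau> \<sigma> \<omega> \<le> J \<rho> \<omega> + J' \<sigma> \<omega>"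
    using facts lower_integrable_AE_finite[OF li_\<zeta>_pos[OF \<sigma>]]
  proof eventually_elim
    case (elim \<omega>)
    show ?case
    proof (cases "\<tau> \<omega> \<le> \<sigma> \<omega>")
      case True
      then have "\<rho> \<omega> = \<tau> \<omega>" by (simp add: \<rho>_def)
      then have eq: "J \<rho> \<omega> = J \<tau> \<omega>" "J' \<rho> \<omega> = J' \<tau> \<omega>" using elim(11,13) by auto
      show ?thesis using True unfolding eq
        using **[OF elim(4) elim(1) elim(5,6) elim(9)] by simp
    next
      case False
      then have "\<rho> \<omega> = \<sigma> \<omega>" by (simp add: \<rho>_def)
      then have eq: "J \<rho> \<omega> = J \<sigma> \<omega>" "J' \<rho> \<omega> = J' \<sigma> \<omega>" using elim(12,14) by auto
      show ?thesis unfolding eq using False elim(7,8,10,15)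
        by (cases "J \<sigma> \<omega>"; cases "J' \<sigma> \<omega>"; cases "\<zeta> \<sigma> \<omega>") auto
    qed
  qed
qed

text \<open>The near-optimal time for \<open>J \<theta>\<close> is fixed before
  \<open>\<sigma>\<close> is known, the order of choices that \<open>V_lower\<close>
  demands.\<close>

lemma lower_strategy:
  assumes \<theta>: "\<theta> \<in> STs" and \<epsilon>: "0 < (\<epsilon>::real)"
  obtains \<tau> where "\<tau> \<in> STs_from \<theta>"
    "\<And>\<sigma>. \<sigma> \<in> STs_from \<theta> \<Longrightarrow> AE \<omega> in M. J \<theta> \<omega> - J' \<theta> \<omega> - \<epsilon> \<le> Icrit M F T \<xi> \<zeta> \<theta> \<tau> \<sigma> \<omega>"
proof -
  interpret G: sigma_finite_subalgebra M "G \<theta>" by (rule sigma_finite_G[OF \<theta>])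
  let ?E = "ecexp M (G \<theta>)"
  obtain \<tau> where \<tau>: "\<tau> \<in> STs_from \<theta>"
    and opt: "AE \<omega> in M. J \<theta> \<omega> - \<epsilon> \<le> ?E (\<lambda>\<omega>. J' \<tau> \<omega> + \<xi> \<tau> \<omega>) \<omega>"
    by (rule snell_eps_optimal[OF adm_\<psi> snell_J \<theta> admissible_measurable[OF adm_J \<theta>] _ J_finite[OF \<theta>] \<epsilon>])
       simp
  note \<tau>ST = ST_from_ST[OF \<tau>]
  show thesis
  proof (rule that[OF \<tau>])
    fix \<sigma> assume \<sigma>: "\<sigma> \<in> STs_from \<theta>"
    note \<sigma>ST = ST_from_ST[OF \<sigma>]
    let ?\<rho> = "\<lambda>\<omega>. min (\<tau> \<omega>) (\<sigma> \<omega>)"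
    have \<rho>: "?\<rho> \<in> STs_from \<theta>" by (rule min_ST_from[OF \<tau> \<sigma>])
    note \<rho>ST = ST_from_ST[OF \<rho>]
    have \<tau>\<rho>: "\<tau> \<in> STs_from ?\<rho>" by (rule ST_from_I[OF \<tau>ST]) simp
    note li = li_\<psi>[OF \<tau>ST] li_J[OF \<rho>ST] li_J'[OF \<rho>ST] li_J[OF \<tau>ST] li_payoff[OF \<tau>ST \<sigma>ST]
    have "AE \<omega> in M. ?E (\<lambda>\<omega>. (J' \<tau> \<omega> + \<xi> \<tau> \<omega>) + J ?\<rho> \<omega>) \<omega>
        \<le> ?E (\<lambda>\<omega>. (payoff \<tau> \<sigma> \<omega> + J' ?\<rho> \<omega>) + J \<tau> \<omega>) \<omega>"
      by (intro G.ecexp_mono game_AE(1)[OF \<tau>ST \<sigma>ST] lower_integrable_measurable lower_integrable_add li)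
    moreover have "AE \<omega> in M. ?E (\<lambda>\<omega>. (J' \<tau> \<omega> + \<xi> \<tau> \<omega>) + J ?\<rho> \<omega>) \<omega>
        = ?E (\<lambda>\<omega>. J' \<tau> \<omega> + \<xi> \<tau> \<omega>) \<omega> + ?E (J ?\<rho>) \<omega>"
      by (intro G.ecexp_add li)
    moreover have "AE \<omega> in M. ?E (\<lambda>\<omega>. (payoff \<tau> \<sigma> \<omega> + J' ?\<rho> \<omega>) + J \<tau> \<omega>) \<omega>
        = ?E (\<lambda>\<omega>. payoff \<tau> \<sigma> \<omega> + J' ?\<rho> \<omega>) \<omega> + ?E (J \<tau>) \<omega>"
      by (intro G.ecexp_add lower_integrable_add li)
    moreover have "AE \<omega> in M. ?E (\<lambda>\<omega>. payoff \<tau> \<sigma> \<omega> + J' ?\<rho> \<omega>) \<omega>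
        = ?E (payoff \<tau> \<sigma>) \<omega> + ?E (J' ?\<rho>) \<omega>"
      by (intro G.ecexp_add li)
    moreover note opt J_finite[OF \<theta>] J'_finite[OF \<theta>]
      G.ecexp_abs_finite[OF meas_J J_nonneg int_J, OF \<rho>ST \<rho>ST \<rho>ST]
      J_antimono[OF \<theta> \<rho> \<tau>\<rho>] J'_supermartingale[OF \<theta> \<rho>]
    ultimately show "AE \<omega> in M. J \<theta> \<omega> - J' \<theta> \<omega> - \<epsilon> \<le> Icrit M F T \<xi> \<zeta> \<theta> \<tau> \<sigma> \<omega>"
    proof eventually_elim
      case (elim \<omega>)
      let ?I = "?E (payoff \<tau> \<sigma>) \<omega>"
      \<comment> \<open>Both surplus terms are replaced by larger ones: \<open>J \<tau>\<close> by
        \<open>J ?\<rho>\<close>, and \<open>J' ?\<rho>\<close> by \<open>J' \<theta>\<close>. The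
        common term is finite and drops out.\<close>
      have "(J \<theta> \<omega> - \<epsilon>) + ?E (J ?\<rho>) \<omega> \<le> (?I + J' \<theta> \<omega>) + ?E (J ?\<rho>) \<omega>"
      proof -
        have "(J \<theta> \<omega> - \<epsilon>) + ?E (J ?\<rho>) \<omega> \<le> ?E (\<lambda>\<omega>. J' \<tau> \<omega> + \<xi> \<tau> \<omega>) \<omega> + ?E (J ?\<rho>) \<omega>"
          using elim(5) by (rule add_right_mono)
        also have "\<dots> \<le> (?I + ?E (J' ?\<rho>) \<omega>) + ?E (J \<tau>) \<omega>" using elim(1-4) by simp
        also have "\<dots> \<le> (?I + J' \<theta> \<omega>) + ?E (J ?\<rho>) \<omega>"
          by (intro add_mono order_refl elim)
        finally show ?thesis .
      qed
      with elim(6-8) have "J \<theta> \<omega> - J' \<theta> \<omega> - \<epsilon> \<le> ?I"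
        by (cases "J \<theta> \<omega>"; cases "J' \<theta> \<omega>"; cases "?E (J ?\<rho>) \<omega>"; cases ?I) auto
      then show ?case unfolding Icrit_def .
    qed
  qed
qed

lemma upper_strategy:
  assumes \<theta>: "\<theta> \<in> STs" and \<epsilon>: "0 < (\<epsilon>::real)"
  obtains \<sigma> where "\<sigma> \<in> STs_from \<theta>"
    "\<And>\<tau>. \<tau> \<in> STs_from \<theta> \<Longrightarrow> AE \<omega> in M. Icrit M F T \<xi> \<zeta> \<theta> \<tau> \<sigma> \<omega> \<le> J \<theta> \<omega> - J' \<theta> \<omega> + \<epsilon>"
proof -
  interpret G: sigma_finite_subalgebra M "G \<theta>" by (rule sigma_finite_G[OF \<theta>])
  let ?E = "ecexp M (G \<theta>)"
  obtain \<sigma> where \<sigma>: "\<sigma> \<in> STs_from \<theta>"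
    and opt: "AE \<omega> in M. J' \<theta> \<omega> - \<epsilon> \<le> ?E (\<lambda>\<omega>. J \<sigma> \<omega> + - \<zeta> \<sigma> \<omega>) \<omega>"
    by (rule snell_eps_optimal[OF adm_\<psi>' snell_J' \<theta> admissible_measurable[OF adm_J' \<theta>] _ J'_finite[OF \<theta>] \<epsilon>])
       simp
  note \<sigma>ST = ST_from_ST[OF \<sigma>]
  show thesis
  proof (rule that[OF \<sigma>])
    fix \<tau> assume \<tau>: "\<tau> \<in> STs_from \<theta>"
    note \<tau>ST = ST_from_ST[OF \<tau>]
    let ?\<rho> = "\<lambda>\<omega>. min (\<tau> \<omega>) (\<sigma> \<omega>)"
    have \<rho>: "?\<rho> \<in> STs_from \<theta>" by (rule min_ST_from[OF \<tau> \<sigma>])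
    note \<rho>ST = ST_from_ST[OF \<rho>]
    have \<sigma>\<rho>: "\<sigma> \<in> STs_from ?\<rho>" by (rule ST_from_I[OF \<sigma>ST]) simp
    note li = li_\<psi>'[OF \<sigma>ST] li_J[OF \<rho>ST] li_J'[OF \<rho>ST] li_J'[OF \<sigma>ST] li_payoff[OF \<tau>ST \<sigma>ST]
    have "AE \<omega> in M. ?E (\<lambda>\<omega>. ((J \<sigma> \<omega> + - \<zeta> \<sigma> \<omega>) + J' ?\<rho> \<omega>) + payoff \<tau> \<sigma> \<omega>) \<omega>
        \<le> ?E (\<lambda>\<omega>. J ?\<rho> \<omega> + J' \<sigma> \<omega>) \<omega>"
      by (intro G.ecexp_mono game_AE(2)[OF \<tau>ST \<sigma>ST] lower_integrable_measurable lower_integrable_add li)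
    moreover have "AE \<omega> in M. ?E (\<lambda>\<omega>. ((J \<sigma> \<omega> + - \<zeta> \<sigma> \<omega>) + J' ?\<rho> \<omega>) + payoff \<tau> \<sigma> \<omega>) \<omega>
        = ?E (\<lambda>\<omega>. (J \<sigma> \<omega> + - \<zeta> \<sigma> \<omega>) + J' ?\<rho> \<omega>) \<omega> + ?E (payoff \<tau> \<sigma>) \<omega>"
      by (rule G.ecexp_add[OF lower_integrable_add[OF li(1,3)] li(5)])
    moreover have "AE \<omega> in M. ?E (\<lambda>\<omega>. (J \<sigma> \<omega> + - \<zeta> \<sigma> \<omega>) + J' ?\<rho> \<omega>) \<omega>
        = ?E (\<lambda>\<omega>. J \<sigma> \<omega> + - \<zeta> \<sigma> \<omega>) \<omega> + ?E (J' ?\<rho>) \<omega>"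
      by (rule G.ecexp_add[OF li(1,3)])
    moreover have "AE \<omega> in M. ?E (\<lambda>\<omega>. J ?\<rho> \<omega> + J' \<sigma> \<omega>) \<omega> = ?E (J ?\<rho>) \<omega> + ?E (J' \<sigma>) \<omega>"
      by (rule G.ecexp_add[OF li(2,4)])
    moreover note opt J_finite[OF \<theta>] J'_finite[OF \<theta>]
      G.ecexp_abs_finite[OF meas_J' J'_nonneg int_J', OF \<rho>ST \<rho>ST \<rho>ST]
      J'_antimono[OF \<theta> \<rho> \<sigma>\<rho>] J_supermartingale[OF \<theta> \<rho>]
    ultimately show "AE \<omega> in M. Icrit M F T \<xi> \<zeta> \<theta> \<tau> \<sigma> \<omega> \<le> J \<theta> \<omega> - J' \<theta> \<omega> + \<epsilon>"
    proof eventually_elim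
      case (elim \<omega>)
      let ?I = "?E (payoff \<tau> \<sigma>) \<omega>"
      \<comment> \<open>Mirror image of the lower bound: \<open>J' \<sigma>\<close> is replaced by
        \<open>J' ?\<rho>\<close>, \<open>J ?\<rho>\<close> by \<open>J \<theta>\<close>, and the
        payoff now sits on the smaller side.\<close>
      have "((J' \<theta> \<omega> - \<epsilon>) + ?E (J' ?\<rho>) \<omega>) + ?I \<le> J \<theta> \<omega> + ?E (J' ?\<rho>) \<omega>"
      proof -
        have "((J' \<theta> \<omega> - \<epsilon>) + ?E (J' ?\<rho>) \<omega>) + ?I
            \<le> (?E (\<lambda>\<omega>. J \<sigma> \<omega> + - \<zeta> \<sigma> \<omega>) \<omega> + ?E (J' ?\<rho>) \<omega>) + ?I"
          by (intro add_right_mono elim)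
        also have "\<dots> \<le> ?E (J ?\<rho>) \<omega> + ?E (J' \<sigma>) \<omega>" using elim(1-4) by simp
        also have "\<dots> \<le> J \<theta> \<omega> + ?E (J' ?\<rho>) \<omega>"
          by (intro add_mono elim)
        finally show ?thesis .
      qed
      with elim(6-8) have "?I \<le> J \<theta> \<omega> - J' \<theta> \<omega> + \<epsilon>"
        by (cases "J \<theta> \<omega>"; cases "J' \<theta> \<omega>"; cases "?E (J' ?\<rho>) \<omega>"; cases ?I) auto
      then show ?case unfolding Icrit_def .
    qed
  qed
qed

lemma fair_game:
  assumes \<theta>: "\<theta> \<in> STs"
  shows "AE \<omega> in M. J \<theta> \<omega> - J' \<theta> \<omega> = V_lower M F T \<xi> \<zeta> \<theta> \<omega> \<and>
    J \<theta> \<omega> - J' \<theta> \<omega> = V_upper M F T \<xi> \<zeta> \<theta> \<omega>"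
proof -
  let ?I = "Icrit M F T \<xi> \<zeta> \<theta>" and ?S = "STs_from \<theta>"
  let ?Y = "\<lambda>\<omega>. J \<theta> \<omega> - J' \<theta> \<omega>"
  have I_meas [measurable]: "?I \<tau> \<sigma> \<in> borel_measurable M" for \<tau> \<sigma>
    unfolding Icrit_def by (rule measurable_ecexp_M[OF \<theta>])
  note [measurable] = meas_J[OF \<theta>] meas_J'[OF \<theta>]
  define m where "m \<tau> = essinfF M ?S (\<lambda>\<sigma>. ?I \<tau> \<sigma>)" for \<tau>
  define s where "s \<sigma> = esssupF M ?S (\<lambda>\<tau>. ?I \<tau> \<sigma>)" for \<sigma>
  have m: "is_essinf M ?S (\<lambda>\<sigma>. ?I \<tau> \<sigma>) (m \<tau>)" for \<tau>
    unfolding m_def by (rule is_essinf_essinfF) simp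
  have s: "is_esssup M ?S (\<lambda>\<tau>. ?I \<tau> \<sigma>) (s \<sigma>)" for \<sigma>
    unfolding s_def by (rule is_esssup_esssupF) simp
  have [measurable]: "m \<tau> \<in> borel_measurable M" "s \<sigma> \<in> borel_measurable M" for \<tau> \<sigma>
    using m s by (auto simp: is_essinf_def is_esssup_def)
  have L: "is_esssup M ?S m (V_lower M F T \<xi> \<zeta> \<theta>)"
    unfolding V_lower_def m_def[abs_def, symmetric] by (rule is_esssup_esssupF) simp
  have U: "is_essinf M ?S s (V_upper M F T \<xi> \<zeta> \<theta>)"
    unfolding V_upper_def s_def[abs_def, symmetric] by (rule is_essinf_essinfF) simp
  have "AE \<omega> in M. ?Y \<omega> - inverse (Suc n) \<le> V_lower M F T \<xi> \<zeta> \<theta> \<omega>" for n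
  proof -
    obtain \<tau> where \<tau>: "\<tau> \<in> ?S" "\<And>\<sigma>. \<sigma> \<in> ?S \<Longrightarrow> AE \<omega> in M. ?Y \<omega> - inverse (Suc n) \<le> ?I \<tau> \<sigma> \<omega>"
      by (rule lower_strategy[OF \<theta>, of "inverse (Suc n)"]) auto
    have "AE \<omega> in M. ?Y \<omega> - inverse (Suc n) \<le> m \<tau> \<omega>"
      using m[of \<tau>] \<tau>(2) unfolding is_essinf_def by simp
    moreover have "AE \<omega> in M. m \<tau> \<omega> \<le> V_lower M F T \<xi> \<zeta> \<theta> \<omega>"
      using L \<tau>(1) unfolding is_esssup_def by simp
    ultimately show ?thesis by eventually_elim simp
  qed
  moreover have "AE \<omega> in M. V_upper M F T \<xi> \<zeta> \<theta> \<omega> \<le> ?Y \<omega> + inverse (Suc n)" for n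
  proof -
    obtain \<sigma> where \<sigma>: "\<sigma> \<in> ?S" "\<And>\<tau>. \<tau> \<in> ?S \<Longrightarrow> AE \<omega> in M. ?I \<tau> \<sigma> \<omega> \<le> ?Y \<omega> + inverse (Suc n)"
      by (rule upper_strategy[OF \<theta>, of "inverse (Suc n)"]) auto
    have "AE \<omega> in M. s \<sigma> \<omega> \<le> ?Y \<omega> + inverse (Suc n)"
      using s[of \<sigma>] \<sigma>(2) unfolding is_esssup_def by simp
    moreover have "AE \<omega> in M. V_upper M F T \<xi> \<zeta> \<theta> \<omega> \<le> s \<sigma> \<omega>"
      using U \<sigma>(1) unfolding is_essinf_def by simp
    ultimately show ?thesis by eventually_elim simp
  qed
  \<comment> \<open>Weak duality: for each pair the criterion lies between the inner infimum and the
    inner supremum. It closes the chain around \<open>?Y\<close>.\<close>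
  moreover have "AE \<omega> in M. V_lower M F T \<xi> \<zeta> \<theta> \<omega> \<le> V_upper M F T \<xi> \<zeta> \<theta> \<omega>"
  proof -
    have "AE \<omega> in M. m \<tau> \<omega> \<le> s \<sigma> \<omega>" if "\<tau> \<in> ?S" "\<sigma> \<in> ?S" for \<tau> \<sigma>
    proof -
      have "AE \<omega> in M. m \<tau> \<omega> \<le> ?I \<tau> \<sigma> \<omega>" "AE \<omega> in M. ?I \<tau> \<sigma> \<omega> \<le> s \<sigma> \<omega>"
        using m[of \<tau>] s[of \<sigma>] that by (auto simp: is_essinf_def is_esssup_def)
      then show ?thesis by eventually_elim simp
    qed
    then have "AE \<omega> in M. V_lower M F T \<xi> \<zeta> \<theta> \<omega> \<le> s \<sigma> \<omega>" if "\<sigma> \<in> ?S" for \<sigma>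
      using L that unfolding is_esssup_def by simp
    moreover have "V_lower M F T \<xi> \<zeta> \<theta> \<in> borel_measurable M" using L by (simp add: is_esssup_def)
    ultimately show ?thesis using U unfolding is_essinf_def by simp
  qed
  \<comment> \<open>Tolerances from a sequence let the exceptional null sets be merged before
    passing to the limit.\<close>
  ultimately have *: "AE \<omega> in M. \<forall>n. ?Y \<omega> - inverse (Suc n) \<le> V_lower M F T \<xi> \<zeta> \<theta> \<omega>"
    "AE \<omega> in M. \<forall>n. V_upper M F T \<xi> \<zeta> \<theta> \<omega> \<le> ?Y \<omega> + inverse (Suc n)"
    "AE \<omega> in M. V_lower M F T \<xi> \<zeta> \<theta> \<omega> \<le> V_upper M F T \<xi> \<zeta> \<theta> \<omega>"
    unfolding AE_all_countable by blast+
  have lim: "(\<lambda>n. ereal (inverse (Suc n))) \<longlonglongrightarrow> 0"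
    unfolding zero_ereal_def lim_ereal by (rule LIMSEQ_inverse_real_of_nat)
  show ?thesis
    using *
  proof eventually_elim
    case (elim \<omega>)
    have "(\<lambda>n. ?Y \<omega> - ereal (inverse (Suc n))) \<longlonglongrightarrow> ?Y \<omega> - 0"
      by (intro tendsto_diff_ereal_general tendsto_const lim) auto
    then have "?Y \<omega> \<le> V_lower M F T \<xi> \<zeta> \<theta> \<omega>"
      using elim(1) by (intro LIMSEQ_le_const2[where x = "?Y \<omega>"]) auto
    moreover have "(\<lambda>n. ?Y \<omega> + ereal (inverse (Suc n))) \<longlonglongrightarrow> ?Y \<omega> + 0"
      by (intro tendsto_add_ereal_general tendsto_const lim) auto
    then have "V_upper M F T \<xi> \<zeta> \<theta> \<omega> \<le> ?Y \<omega>"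
      using elim(2) by (intro LIMSEQ_le_const[where x = "?Y \<omega>"]) auto
    ultimately show ?case using elim(3) by auto
  qed
qed

end

subsection \<open>The iterated families\<close>

context dynkin_game
begin

abbreviation "Js \<equiv> Jn M F T \<xi> \<zeta>"
abbreviation "Js' \<equiv> J'n M F T \<xi> \<zeta>"

lemma Js_0: "Js 0 = (\<lambda>_ _. 0)" "Js' 0 = (\<lambda>_ _. 0)"
  by (simp_all add: Jn_def J'n_def)

lemma snell_Js_Suc:
  "snell (\<lambda>\<tau> \<omega>. Js' n \<tau> \<omega> + \<xi> \<tau> \<omega>) (Js (Suc n))"
  "snell (\<lambda>\<tau> \<omega>. Js n \<tau> \<omega> + - \<zeta> \<tau> \<omega>) (Js' (Suc n))"
  using snell_esssupF[of "\<lambda>\<tau> \<omega>. Js' n \<tau> \<omega> + \<xi> \<tau> \<omega>"] snell_esssupF[of "\<lambda>\<tau> \<omega>. Js n \<tau> \<omega> + - \<zeta> \<tau> \<omega>"]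
  by (simp_all add: Jn_def J'n_def minus_ereal_def)

lemma adm_Js: "admissible M F T (Js n)" "admissible M F T (Js' n)"
proof (induction n)
  case 0
  { case 1 show ?case by (simp add: Js_0 admissible_def) }
  { case 2 show ?case by (simp add: Js_0 admissible_def) }
next
  case (Suc n)
  { case 1 show ?case
      by (rule admissible_snell[OF admissible_add[OF Suc(2) adm_\<xi>] snell_Js_Suc(1)]) }
  { case 2 show ?case
      by (rule admissible_snell[OF admissible_add[OF Suc(1) admissible_uminus[OF adm_\<zeta>]] snell_Js_Suc(2)]) }
qed

lemmas adm_rewards = admissible_add[OF adm_Js(2) adm_\<xi>] admissible_add[OF adm_Js(1) admissible_uminus[OF adm_\<zeta>]]

text \<open>Each family is the envelope of a reward built from the other, so both inductions run
  jointly. Nonnegativity comes from waiting until \<open>T\<close>, where \<open>\<xi>\<close> and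
  \<open>\<zeta>\<close> vanish.\<close>

lemma Js_mono_nonneg:
  assumes T: "AE \<omega> in M. \<xi> (\<lambda>_. T) \<omega> = 0" "AE \<omega> in M. \<zeta> (\<lambda>_. T) \<omega> = 0"
  shows "\<theta> \<in> STs \<Longrightarrow> AE \<omega> in M. 0 \<le> Js n \<theta> \<omega>" "\<theta> \<in> STs \<Longrightarrow> AE \<omega> in M. 0 \<le> Js' n \<theta> \<omega>"
    "\<theta> \<in> STs \<Longrightarrow> AE \<omega> in M. Js n \<theta> \<omega> \<le> Js (Suc n) \<theta> \<omega>"
    "\<theta> \<in> STs \<Longrightarrow> AE \<omega> in M. Js' n \<theta> \<omega> \<le> Js' (Suc n) \<theta> \<omega>"
proof -
  have T_ST: "(\<lambda>_. T) \<in> STs" using T_pos by (intro const_ST) auto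
  have nn: "(\<forall>\<theta>\<in>STs. AE \<omega> in M. 0 \<le> Js n \<theta> \<omega>) \<and> (\<forall>\<theta>\<in>STs. AE \<omega> in M. 0 \<le> Js' n \<theta> \<omega>)" for n
  proof (induction n)
    case 0 then show ?case by (simp add: Js_0)
  next
    case (Suc n)
    have "AE \<omega> in M. 0 \<le> Js n (\<lambda>_. T) \<omega>" "AE \<omega> in M. 0 \<le> Js' n (\<lambda>_. T) \<omega>"
      using Suc T_ST by auto
    with T have "AE \<omega> in M. 0 \<le> Js' n (\<lambda>_. T) \<omega> + \<xi> (\<lambda>_. T) \<omega>"
      "AE \<omega> in M. 0 \<le> Js n (\<lambda>_. T) \<omega> + - \<zeta> (\<lambda>_. T) \<omega>"
      by (eventually_elim, simp)+
    then show ?case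
      using snell_nonneg[OF adm_rewards(1) _ snell_Js_Suc(1)] snell_nonneg[OF adm_rewards(2) _ snell_Js_Suc(2)]
      by simp
  qed
  show "\<theta> \<in> STs \<Longrightarrow> AE \<omega> in M. 0 \<le> Js n \<theta> \<omega>" "\<theta> \<in> STs \<Longrightarrow> AE \<omega> in M. 0 \<le> Js' n \<theta> \<omega>"
    using nn by auto
  have mono: "(\<forall>\<theta>\<in>STs. AE \<omega> in M. Js n \<theta> \<omega> \<le> Js (Suc n) \<theta> \<omega>) \<and>
      (\<forall>\<theta>\<in>STs. AE \<omega> in M. Js' n \<theta> \<omega> \<le> Js' (Suc n) \<theta> \<omega>)" for n
  proof (induction n)
    \<comment> \<open>The iterates start at 0, so the first increase is nonnegativity of the first
      iterates.\<close>
    case 0 show ?case using nn[of 1] by (simp add: Js_0)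
  next
    case (Suc n)
    show ?case
    proof (intro conjI ballI)
      fix \<theta> assume \<theta>: "\<theta> \<in> STs"
      show "AE \<omega> in M. Js (Suc n) \<theta> \<omega> \<le> Js (Suc (Suc n)) \<theta> \<omega>"
      proof (rule snell_mono[OF adm_rewards(1) adm_rewards(1) snell_Js_Suc(1) snell_Js_Suc(1) _ \<theta>])
        fix \<tau> assume "\<tau> \<in> STs"
        with Suc have "AE \<omega> in M. Js' n \<tau> \<omega> \<le> Js' (Suc n) \<tau> \<omega>" by simp
        then show "AE \<omega> in M. Js' n \<tau> \<omega> + \<xi> \<tau> \<omega> \<le> Js' (Suc n) \<tau> \<omega> + \<xi> \<tau> \<omega>"
          by eventually_elim (rule add_right_mono)
      qed
      show "AE \<omega> in M. Js' (Suc n) \<theta> \<omega> \<le> Js' (Suc (Suc n)) \<theta> \<omega>"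
      proof (rule snell_mono[OF adm_rewards(2) adm_rewards(2) snell_Js_Suc(2) snell_Js_Suc(2) _ \<theta>])
        fix \<tau> assume "\<tau> \<in> STs"
        with Suc have "AE \<omega> in M. Js n \<tau> \<omega> \<le> Js (Suc n) \<tau> \<omega>" by simp
        then show "AE \<omega> in M. Js n \<tau> \<omega> + - \<zeta> \<tau> \<omega> \<le> Js (Suc n) \<tau> \<omega> + - \<zeta> \<tau> \<omega>"
          by eventually_elim (rule add_right_mono)
      qed
    qed
  qed
  show "\<theta> \<in> STs \<Longrightarrow> AE \<omega> in M. Js n \<theta> \<omega> \<le> Js (Suc n) \<theta> \<omega>"
    "\<theta> \<in> STs \<Longrightarrow> AE \<omega> in M. Js' n \<theta> \<omega> \<le> Js' (Suc n) \<theta> \<omega>"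
    using mono by auto
qed

lemma snell_system_Jfam:
  assumes T: "AE \<omega> in M. \<xi> (\<lambda>_. T) \<omega> = 0" "AE \<omega> in M. \<zeta> (\<lambda>_. T) \<omega> = 0"
    and triv: "\<forall>A\<in>sets (F 0). measure M A = 0 \<or> measure M A = 1"
    and J0: "AE \<omega> in M. Jfam M F T \<xi> \<zeta> (\<lambda>_. 0) \<omega> < \<infinity>"
  shows "snell_system M F T \<xi> \<zeta> (Jfam M F T \<xi> \<zeta>) (J'fam M F T \<xi> \<zeta>)"
proof -
  let ?J = "Jfam M F T \<xi> \<zeta>" and ?J' = "J'fam M F T \<xi> \<zeta>"
  note nn = Js_mono_nonneg(1,2)[OF T] and mono = Js_mono_nonneg(3,4)[OF T]
  have adm_J: "admissible M F T ?J" unfolding Jfam_def by (rule admissible_limsup[OF adm_Js(1)])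
  have adm_J': "admissible M F T ?J'" unfolding J'fam_def by (rule admissible_limsup[OF adm_Js(2)])
  have J: "AE \<omega> in M. ?J \<theta> \<omega> = (SUP n. Js n \<theta> \<omega>)" if "\<theta> \<in> STs" for \<theta>
    unfolding Jfam_def by (rule AE_limsup_eq_SUP[of "\<lambda>n. Js n \<theta>", OF mono(1)[OF that]])
  have J': "AE \<omega> in M. ?J' \<theta> \<omega> = (SUP n. Js' n \<theta> \<omega>)" if "\<theta> \<in> STs" for \<theta>
    unfolding J'fam_def by (rule AE_limsup_eq_SUP[of "\<lambda>n. Js' n \<theta>", OF mono(2)[OF that]])
  have J_nn: "AE \<omega> in M. 0 \<le> ?J \<theta> \<omega>" if "\<theta> \<in> STs" for \<theta>
    using J[OF that] nn(1)[OF that, of 0] by eventually_elim (auto intro: SUP_upper2[of 0])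
  have J'_nn: "AE \<omega> in M. 0 \<le> ?J' \<theta> \<omega>" if "\<theta> \<in> STs" for \<theta>
    using J'[OF that] nn(2)[OF that, of 0] by eventually_elim (auto intro: SUP_upper2[of 0])
  have sJ: "snell (\<lambda>\<tau> \<omega>. ?J' \<tau> \<omega> + \<xi> \<tau> \<omega>) ?J"
    by (rule snell_SUP[where \<phi> = Js' and v = Js, OF adm_\<xi> li_\<xi> adm_Js(2) nn(2) mono(2) adm_J' J' snell_Js_Suc(1) mono(1) adm_J J])
  have sJ': "snell (\<lambda>\<tau> \<omega>. ?J \<tau> \<omega> + - \<zeta> \<tau> \<omega>) ?J'"
    by (rule snell_SUP[where \<phi> = Js and v = Js', OF admissible_uminus[OF adm_\<zeta>] li_\<zeta> adm_Js(1) nn(1) mono(1) adm_J J snell_Js_Suc(2) mono(2) adm_J' J'])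
  have ST0: "(\<lambda>_. 0) \<in> STs" using T_pos by (intro const_ST) auto
  interpret G0: sigma_finite_subalgebra M "G (\<lambda>_. 0)" by (rule sigma_finite_G[OF ST0])
  \<comment> \<open>Triviality of \<open>F 0\<close> upgrades finiteness at time 0 to a constant
    bound, which then bounds the expectation of \<open>?J \<tau>\<close> for every
    \<open>\<tau>\<close>.\<close>
  obtain k where k: "AE \<omega> in M. ?J (\<lambda>_. 0) \<omega> \<le> ereal (real k)"
    by (rule AE_bounded_of_trivial[OF triv admissible_measurable[OF adm_J ST0] J0])
  have "(\<integral>\<^sup>+ \<omega>. e2ennreal (?J \<tau> \<omega>) \<partial>M) < \<infinity>" if \<tau>: "\<tau> \<in> STs" for \<tau>
  proof -
    note [measurable] = admissible_measurable_M[OF adm_J \<tau>]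
    have \<tau>0: "\<tau> \<in> STs_from (\<lambda>_. 0)"
      using ST_bounds[OF \<tau>] by (intro ST_from_I[OF \<tau>] AE_I2) auto
    \<comment> \<open>No circularity arises: the supermartingale property was proved for envelopes
      that may be infinite.\<close>
    have "AE \<omega> in M. ecexp M (G (\<lambda>_. 0)) (?J \<tau>) \<omega> \<le> ?J (\<lambda>_. 0) \<omega>"
      by (rule snell_supermartingale[OF admissible_add[OF adm_J' adm_\<xi>] _ sJ J_nn ST0 \<tau>0])
         (intro lower_integrable_add lower_integrable_nonneg li_\<xi> J'_nn admissible_measurable_M[OF adm_J'])
    with k G0.ecexp_nonneg[OF admissible_measurable_M[OF adm_J \<tau>] J_nn[OF \<tau>]]
    have "AE \<omega> in M. nn_cond_exp M (G (\<lambda>_. 0)) (\<lambda>x. e2ennreal (?J \<tau> x)) \<omega> \<le> ennreal (real k)"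
      by eventually_elim (simp add: less_eq_ennreal.rep_eq del: ennreal_of_nat_eq_real_of_nat)
    then have "(\<integral>\<^sup>+ \<omega>. nn_cond_exp M (G (\<lambda>_. 0)) (\<lambda>x. e2ennreal (?J \<tau> x)) \<omega> \<partial>M) \<le> (\<integral>\<^sup>+ \<omega>. ennreal (real k) \<partial>M)"
      by (rule nn_integral_mono_AE)
    moreover have "(\<integral>\<^sup>+ \<omega>. ennreal (real k) \<partial>M) < \<infinity>"
      by (simp add: emeasure_space_1)
    moreover have "(\<integral>\<^sup>+ \<omega>. nn_cond_exp M (G (\<lambda>_. 0)) (\<lambda>x. e2ennreal (?J \<tau> x)) \<omega> \<partial>M) = (\<integral>\<^sup>+ \<omega>. e2ennreal (?J \<tau> \<omega>) \<partial>M)"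
      using G0.nn_cond_exp_intg[of "\<lambda>_. 1" "\<lambda>x. e2ennreal (?J \<tau> x)"] by simp
    ultimately show ?thesis by simp
  qed
  then show ?thesis
    by unfold_locales (use adm_J adm_J' J_nn J'_nn sJ sJ' in auto)
qed

end

theorem theorem3p2:
  fixes M :: "'a measure" and F :: "real \<Rightarrow> 'a measure" and T :: real
    and \<xi> \<zeta> :: "'a family"
  assumes "prob_space M"
    and "0 < T"
    and "usual_filtration M F T"
    and "sets (F T) = sets M"
    and "\<forall>A\<in>sets (F 0). measure M A = 0 \<or> measure M A = 1"
    and "admissible M F T \<xi>" and "admissible M F T \<zeta>"
    and "(\<integral>\<^sup>+ \<omega>. e2ennreal (esssupF M (ST M F T) (\<lambda>\<theta> \<omega>. max 0 (- \<xi> \<theta> \<omega>)) \<omega>) \<partial>M) < \<infinity>"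
    and "(\<integral>\<^sup>+ \<omega>. e2ennreal (esssupF M (ST M F T) (\<lambda>\<theta> \<omega>. max 0 (\<zeta> \<theta> \<omega>)) \<omega>) \<partial>M) < \<infinity>"
    and "AE \<omega> in M. \<xi> (\<lambda>_. T) \<omega> = 0"
    and "AE \<omega> in M. \<zeta> (\<lambda>_. T) \<omega> = 0"
    and "AE \<omega> in M. Jfam M F T \<xi> \<zeta> (\<lambda>_. 0) \<omega> < \<infinity>"
    and "right_USCE M F T \<xi>"
    and "right_USCE M F T (\<lambda>\<theta> \<omega>. - \<zeta> \<theta> \<omega>)"
  shows "\<forall>\<theta>\<in>ST M F T. AE \<omega> in M.
           Yfam M F T \<xi> \<zeta> \<theta> \<omega> = V_lower M F T \<xi> \<zeta> \<theta> \<omega> \<and>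
           Yfam M F T \<xi> \<zeta> \<theta> \<omega> = V_upper M F T \<xi> \<zeta> \<theta> \<omega>"
proof -
  interpret prob_space M by fact
  interpret usual_filtered_space M F T
    by unfold_locales (fact assms)+
  interpret dynkin_game M F T \<xi> \<zeta>
  proof
    show "lower_integrable M (\<xi> \<tau>)" if "\<tau> \<in> STs" for \<tau>
      by (rule lower_integrable_of_esssup[OF admissible_measurable_M[OF assms(6)] assms(8) that])
    \<comment> \<open>The negative part of \<open>- \<zeta>\<close> is the positive part of
      \<open>\<zeta>\<close>, whose essential supremum is integrable.\<close>
    show "lower_integrable M (\<lambda>\<omega>. - \<zeta> \<tau> \<omega>)" if "\<tau> \<in> STs" for \<tau>
      using lower_integrable_of_esssup[of STs "\<lambda>\<tau> \<omega>. - \<zeta> \<tau> \<omega>"] assms(9) that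
        admissible_measurable_M[OF admissible_uminus[OF assms(7)]] by simp
  qed (fact assms)+
  interpret snell_system M F T \<xi> \<zeta> "Jfam M F T \<xi> \<zeta>" "J'fam M F T \<xi> \<zeta>"
    by (rule snell_system_Jfam) (fact assms)+
  show ?thesis unfolding Yfam_def using fair_game by blast
qed

end
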